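(* For each set partition $\pi$ of $[n]$, let $\lambda\vdash n$ be the unique partition such that $w(\pi)=\pi_\lambda$ for some $w\in\mathfrak{S}_n$, and set $p(\pi):=w^{-1}.(w\star\pi)\in V(n)$ (note $w\star\pi=\pm\pi_\lambda\in V(n)$). Then $p(\pi)$ does not depend on the choice of $w$ with $w(\pi)=\pi_\lambda$, and its linear extension $p:P(n)\to V(n)$ is a surjective homomorphism of $\mathbb{Q}\mathfrak{S}_n$-modules (i.e. $p(u\star x)=u.p(x)$ for all $u\in\mathfrak{S}_n$, $x\in P(n)$) which is a projection onto $V(n)$: $p(\pi)=\pi$ for every noncrossing partition $\pi$ of $[n]$. Moreover, $p(\pi)=-\sigma(\pi)$ for every almost noncrossing partition $\pi$ of $[n]$.
   Context: $[n]=\{1,\dots,n\}$, $s_i=(i,i+1)\in\mathfrak{S}_n$. For $w\in\mathfrak{S}_n$ and a set partition $\pi$ of $[n]$, $w(\pi)$ is the set partition in which $w(a),w(b)$ share a block iff $a,b$ share a block of $\pi$; $B_i(\pi)$ is the block of $\pi$ containing $i$. For $\lambda=(\lambda_1,\dots,\lambda_m)\vdash n$, $\pi_\lambda=\{\{1,\dots,\lambda_1\},\{\lambda_1+1,\dots,\lambda_1+\lambda_2\},\dots,\{n-\lambda_m+1,\dots,n\}\}$; every set partition of $[n]$ is in the $\mathfrak{S}_n$-orbit of exactly one $\pi_\lambda$. $P(n)$ is the $\mathbb{Q}$-vector space with basis all set partitions of $[n]$. The action $\star$ of $\mathfrak{S}_n$ on $P(n)$ is defined by $s_i\star\pi=-s_i(\pi)$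 if neither $\{i\}$ nor $\{i+1\}$ is a block of $\pi$, and $s_i\star\pi=s_i(\pi)$ otherwise (these operators satisfy the Coxeter relations, so this is a well-defined action; $w\star\pi=\pm w(\pi)$). A set partition is noncrossing if whenever $a<b<c<d$ with $a,c$ in one block and $b,d$ in one block, all four are in the same block; $NC(n)$ is the set of noncrossing partitions of $[n]$. A set partition $\pi$ is almost noncrossing if it is not noncrossing but $s_i(\pi)$ is noncrossing for some $i$; then $\pi$ crosses at $i$. Skein map: for $\pi$ almost noncrossing crossing at $i$, write $B_i(\pi)=\{i,a_1,\dots,a_k\}$, $B_{i+1}(\pi)=\{i+1,b_1,\dots,b_\ell\}$ ($k,\ell\ge1$); let $\pi_1=s_i(\pi)$ and let $\pi_2,\pi_3,\pi_4$ be obtained from $\pi$ by replacing $B_i(\pi),B_{i+1}(\pi)$ by $\{i,i+1\},\{a_1..a_k,b_1..b_\ell\}$ (for $\pi_2$), $\{i,i+1,a_1..a_k\},\{b_1..b_\ell\}$ (for $\pi_3$), $\{i,i+1,b_1..b_\ell\},\{a_1..a_k\}$ (for $\pi_4$). Then $\sigma(\pi)=\pi_1+\pi_2-\pi_3-\pi_4$ if $k,\ell\ge2$, with the $\pi_3$ term deleted if $\ell=1$ and the $\pi_4$ term deleted if $k=1$; this is independent of the chosen crossing index. $V(n)\subseteq P(n)$ is the subspace with basis $NC(n)$. For $1\le i\le n-1$, $\tau_i$ is the linear operator on $V(n)$ defined on $\pi\in NC(n)$ by: $\tau_i(\pi)=s_i(\pi)$ if $s_i(\pi)$ is noncrossing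 and $B_i(\pi)\ne B_{i+1}(\pi)$; $\tau_i(\pi)=-\pi$ if $B_i(\pi)=B_{i+1}(\pi)$; $\tau_i(\pi)=\sigma(s_i(\pi))$ otherwise. The assignment $s_i\mapsto\tau_i$ defines an action $w.v$ of $\mathfrak{S}_n$ on $V(n)$. *)

theory Defs
  imports
    Complex_Main
    "HOL-Library.Disjoint_Sets"
    "HOL-Library.Poly_Mapping"
    "HOL-Combinatorics.Permutations"
    "HOL-Algebra.Sym_Groups"
    "HOL-Algebra.Group_Action"
begin

type_synonym setpart = "nat set set"

definition set_partitions :: "nat \<Rightarrow> setpart set" where
  "set_partitions n = {\<pi>. partition_on {1..n} \<pi>}"

definition perm_part :: "(nat \<Rightarrow> nat) \<Rightarrow> setpart \<Rightarrow> setpart" where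
  "perm_part w \<pi> = (\<lambda>B. w ` B) ` \<pi>"

abbreviation adj :: "nat \<Rightarrow> nat \<Rightarrow> nat" where
  "adj i \<equiv> transpose i (Suc i)"

definition block :: "nat \<Rightarrow> setpart \<Rightarrow> nat set" where
  "block i \<pi> = (THE B. B \<in> \<pi> \<and> i \<in> B)"

definition int_partition :: "nat \<Rightarrow> nat list \<Rightarrow> bool" where
  "int_partition n ls \<longleftrightarrow>
     sorted_wrt (\<ge>) ls \<and> (\<forall>k\<in>set ls. 0 < k) \<and> sum_list ls = n"

definition std_part :: "nat list \<Rightarrow> setpart" where
  "std_part ls =
     {{sum_list (take j ls) + 1 .. sum_list (take (Suc j) ls)} | j. j < length ls}"

definition shape :: "nat \<Rightarrow> setpart \<Rightarrow> nat list" where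
  "shape n \<pi> = (THE ls. int_partition n ls \<and>
     (\<exists>w. w permutes {1..n} \<and> perm_part w \<pi> = std_part ls))"

definition noncrossing :: "setpart \<Rightarrow> bool" where
  "noncrossing \<pi> \<longleftrightarrow>
     (\<forall>a b c d. \<forall>A\<in>\<pi>. \<forall>B\<in>\<pi>. a < b \<and> b < c \<and> c < d \<and>
        a \<in> A \<and> c \<in> A \<and> b \<in> B \<and> d \<in> B \<longrightarrow> A = B)"

definition NC :: "nat \<Rightarrow> setpart set" where
  "NC n = {\<pi> \<in> set_partitions n. noncrossing \<pi>}"

definition crosses_at :: "nat \<Rightarrow> setpart \<Rightarrow> nat \<Rightarrow> bool" where
  "crosses_at n \<pi> i \<longleftrightarrow>
     \<pi> \<in> set_partitions n \<and> \<not> noncrossing \<pi> \<and>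
     i \<in> {1..<n} \<and> noncrossing (perm_part (adj i) \<pi>)"

definition almost_noncrossing :: "nat \<Rightarrow> setpart \<Rightarrow> bool" where
  "almost_noncrossing n \<pi> \<longleftrightarrow> (\<exists>i. crosses_at n \<pi> i)"

text \<open>Vectors are finitely supported rational combinations of set partitions; P(n) and V(n)
  are the subspaces of vectors supported on the set partitions of [n], respectively on NC(n).\<close>

type_synonym vec = "setpart \<Rightarrow>\<^sub>0 rat"

definition basis :: "setpart \<Rightarrow> vec" where
  "basis \<pi> = Poly_Mapping.single \<pi> 1"

definition scale :: "rat \<Rightarrow> vec \<Rightarrow> vec" where
  "scale c x = Poly_Mapping.map (\<lambda>a. c * a) x"

definition lin_ext :: "(setpart \<Rightarrow> vec) \<Rightarrow> vec \<Rightarrow> vec" where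
  "lin_ext f x = (\<Sum>\<pi>\<in>Poly_Mapping.keys x. scale (Poly_Mapping.lookup x \<pi>) (f \<pi>))"

definition P_space :: "nat \<Rightarrow> vec set" where
  "P_space n = {x. Poly_Mapping.keys x \<subseteq> set_partitions n}"

definition V_space :: "nat \<Rightarrow> vec set" where
  "V_space n = {x. Poly_Mapping.keys x \<subseteq> NC n}"

text \<open>The action of the symmetric group on the set \<open>E\<close> in which the adjacent transposition
  \<open>s\<^sub>i\<close> acts by \<open>T i\<close>. Adjacent transpositions generate the group, so there is at most one such
  action up to the junk values of \<open>\<phi>\<close> at non-permutations, which are irrelevant; if the
  operators \<open>T i\<close> are linear, so is the action.\<close>

definition gen_action :: "nat \<Rightarrow> vec set \<Rightarrow> (nat \<Rightarrow> vec \<Rightarrow> vec) \<Rightarrow> (nat \<Rightarrow> nat) \<Rightarrow> vec \<Rightarrow> vec" where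
  "gen_action n E T = (SOME \<phi>. group_action (sym_group n) E \<phi> \<and>
     (\<forall>i\<in>{1..<n}. \<forall>x\<in>E. \<phi> (adj i) x = T i x))"

definition star_gen :: "nat \<Rightarrow> setpart \<Rightarrow> vec" where
  "star_gen i \<pi> =
     (if {i} \<notin> \<pi> \<and> {Suc i} \<notin> \<pi> then - basis (perm_part (adj i) \<pi>)
      else basis (perm_part (adj i) \<pi>))"

definition star :: "nat \<Rightarrow> (nat \<Rightarrow> nat) \<Rightarrow> vec \<Rightarrow> vec" where
  "star n = gen_action n (P_space n) (\<lambda>i. lin_ext (star_gen i))"

text \<open>The skein relation at a crossing index \<open>i\<close>; \<open>A\<close> is \<open>{a\<^sub>1, \<dots>, a\<^sub>k}\<close> and \<open>B\<close> is
  \<open>{b\<^sub>1, \<dots>, b\<^sub>l}\<close>.\<close>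

definition skein_at :: "nat \<Rightarrow> setpart \<Rightarrow> vec" where
  "skein_at i \<pi> =
     (let A = block i \<pi> - {i};
          B = block (Suc i) \<pi> - {Suc i};
          R = \<pi> - {block i \<pi>, block (Suc i) \<pi>};
          \<pi>1 = perm_part (adj i) \<pi>;
          \<pi>2 = R \<union> {{i, Suc i}, A \<union> B};
          \<pi>3 = R \<union> {{i, Suc i} \<union> A, B};
          \<pi>4 = R \<union> {{i, Suc i} \<union> B, A}
      in basis \<pi>1 + basis \<pi>2
         - (if card B = 1 then 0 else basis \<pi>3)
         - (if card A = 1 then 0 else basis \<pi>4))"

text \<open>The value does not depend on which crossing index is chosen.\<close>

definition skein :: "nat \<Rightarrow> setpart \<Rightarrow> vec" where
  "skein n \<pi> = skein_at (SOME i. crosses_at n \<pi> i) \<pi>"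

definition tau_gen :: "nat \<Rightarrow> nat \<Rightarrow> setpart \<Rightarrow> vec" where
  "tau_gen n i \<pi> =
     (if noncrossing (perm_part (adj i) \<pi>) \<and> block i \<pi> \<noteq> block (Suc i) \<pi>
        then basis (perm_part (adj i) \<pi>)
      else if block i \<pi> = block (Suc i) \<pi> then - basis \<pi>
      else skein n (perm_part (adj i) \<pi>))"

definition skein_action :: "nat \<Rightarrow> (nat \<Rightarrow> nat) \<Rightarrow> vec \<Rightarrow> vec" where
  "skein_action n = gen_action n (V_space n) (\<lambda>i. lin_ext (tau_gen n i))"

definition standardizes :: "nat \<Rightarrow> (nat \<Rightarrow> nat) \<Rightarrow> setpart \<Rightarrow> bool" where
  "standardizes n w \<pi> \<longleftrightarrow> w permutes {1..n} \<and> perm_part w \<pi> = std_part (shape n \<pi>)"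

definition proj_via :: "nat \<Rightarrow> (nat \<Rightarrow> nat) \<Rightarrow> setpart \<Rightarrow> vec" where
  "proj_via n w \<pi> = skein_action n (inv' w) (star n w (basis \<pi>))"

definition proj_basis :: "nat \<Rightarrow> setpart \<Rightarrow> vec" where
  "proj_basis n \<pi> = proj_via n (SOME w. standardizes n w \<pi>) \<pi>"

definition proj :: "nat \<Rightarrow> vec \<Rightarrow> vec" where
  "proj n = lin_ext (proj_basis n)"

end

theory Submission
  imports Defs
begin

text \<open>
  The action \<open>\<star>\<close> is \<open>w \<star> \<pi> = \<epsilon> w(\<pi>)\<close>, where \<open>\<epsilon>\<close> is the sign of the inversions of \<open>w\<close> among the
  elements of \<open>[n]\<close> that are not singleton blocks of \<open>\<pi>\<close> (the core of \<open>\<pi>\<close>). Consider the linear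
  forms on \<open>P(n)\<close> sending \<open>\<pi>\<close> to \<open>det [s\<^sub>i and t\<^sub>j share a block of \<pi>]\<close> if \<open>\<pi>\<close> has a prescribed core
  and \<open>k\<close> nonsingleton blocks, and to 0 otherwise, where \<open>s\<close> and \<open>t\<close> are disjoint sequences of
  length \<open>k\<close>. Their common kernel \<open>K\<close> is a submodule. By a Plucker-type identity for 2-by-2 minors,
  \<open>\<pi> + \<sigma>(\<pi>)\<close> lies in \<open>K\<close> for every almost noncrossing \<open>\<pi>\<close>; since moreover every orbit contains some
  \<open>\<pi>\<^sub>\<lambda>\<close>, this gives \<open>P(n) = V(n) + K\<close>. Taking for \<open>s\<close> and \<open>t\<close> the minima and maxima of the blocks of a
  noncrossing partition shows by triangularity that \<open>V(n) \<inter> K = 0\<close>. Hence the action on \<open>V(n)\<close> is the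
  one transported from \<open>P(n) / K\<close>, and \<open>p\<close> is the projection onto \<open>V(n)\<close> along \<open>K\<close>.
\<close>

section \<open>Vectors and linear extension\<close>

text \<open>The action on V(n) is known only through generators, and \<open>skein\<close> uses an
  unspecified crossing index. Checking the Coxeter relations for \<open>tau_gen\<close>, or
  independence of the index, head-on would be a large case analysis. The complement \<open>K\<close>
  avoids it: as V(n) meets \<open>K\<close> only in 0, a vector of V(n) is determined by its class
  modulo \<open>K\<close>, so \<sigma>(\<pi>) is the only representative of -\<pi>, and
  \<open>tau_gen n i \<pi>\<close> the only one of s_i \<star> \<pi>.

  The forms come from exterior algebra. Let 1_B be the indicator vector of a block B. By
  Cauchy-Binet and disjointness of s and t, the determinant is a coordinate of the tensor square of
  the wedge product of the 1_B over the k nonsingleton blocks; squaring cancels the sign of an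
  ordering of the blocks. Disjointness removes the coordinates in which a point occurs in both
  factors, where the skein relation can fail. Fixing the core makes the sign of \<star> constant on
  the support of a form, which is why the kernel is stable.\<close>

lemma lookup_scale [simp]:
  "Poly_Mapping.lookup (scale c x) \<pi> = c * Poly_Mapping.lookup x \<pi>"
  by (simp add: scale_def Poly_Mapping.map.rep_eq when_def)

lemma lookup_basis: "Poly_Mapping.lookup (basis \<pi>) \<rho> = (if \<pi> = \<rho> then 1 else 0)"
  by (simp add: basis_def lookup_single when_def)

lemma keys_basis [simp]: "Poly_Mapping.keys (basis \<pi>) = {\<pi>}"
  by (simp add: basis_def)

definition pairing :: "(setpart \<Rightarrow> rat) \<Rightarrow> vec \<Rightarrow> rat" where
  "pairing g x = (\<Sum>\<pi>\<in>Poly_Mapping.keys x. Poly_Mapping.lookup x \<pi> * g \<pi>)"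

lemma pairing_superset:
  assumes "finite S" "Poly_Mapping.keys x \<subseteq> S"
  shows "pairing g x = (\<Sum>\<pi>\<in>S. Poly_Mapping.lookup x \<pi> * g \<pi>)"
  unfolding pairing_def using assms
  by (intro sum.mono_neutral_left) (auto simp: in_keys_iff)

lemma pairing_0 [simp]: "pairing g 0 = 0"
  by (simp add: pairing_def)

lemma pairing_add: "pairing g (x + y) = pairing g x + pairing g y"
proof -
  let ?S = "Poly_Mapping.keys x \<union> Poly_Mapping.keys y"
  have "Poly_Mapping.keys (x + y) \<subseteq> ?S" by (rule keys_add)
  then show ?thesis
    by (simp add: pairing_superset[of ?S] lookup_add algebra_simps sum.distrib)
qed

lemma pairing_scale: "pairing g (scale c x) = c * pairing g x"
proof -
  have "Poly_Mapping.keys (scale c x) \<subseteq> Poly_Mapping.keys x"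
    by (auto simp: in_keys_iff)
  then show ?thesis
    by (simp add: pairing_superset[of "Poly_Mapping.keys x"] sum_distrib_left mult_ac)
qed

lemma scale_minus_1: "scale (- 1) x = - x"
  by (rule poly_mapping_eqI) simp

lemma scale_1 [simp]: "scale 1 x = x"
  by (rule poly_mapping_eqI) simp

lemma scale_scale [simp]: "scale a (scale b x) = scale (a * b) x"
  by (rule poly_mapping_eqI) simp

lemma scale_diff: "scale a (x - y) = scale a x - scale a y"
  by (rule poly_mapping_eqI) (simp add: lookup_minus algebra_simps)

lemma pairing_uminus: "pairing g (- x) = - pairing g x"
  using pairing_scale[of g "- 1" x] by (simp add: scale_minus_1)

lemma pairing_diff: "pairing g (x - y) = pairing g x - pairing g y"
  using pairing_add[of g x "- y"] by (simp add: pairing_uminus)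

lemma pairing_basis [simp]: "pairing g (basis \<pi>) = g \<pi>"
  by (simp add: pairing_def lookup_basis)

text \<open>Each coordinate of a linear extension is a pairing, so linearity of
  \<open>lin_ext\<close> reduces coordinatewise to that of \<open>pairing\<close>.\<close>

lemma lookup_lin_ext:
  "Poly_Mapping.lookup (lin_ext f x) \<rho> = pairing (\<lambda>\<pi>. Poly_Mapping.lookup (f \<pi>) \<rho>) x"
  by (simp add: lin_ext_def lookup_sum pairing_def)

lemma lin_ext_0 [simp]: "lin_ext f 0 = 0"
  by (simp add: lin_ext_def)

lemma lin_ext_add: "lin_ext f (x + y) = lin_ext f x + lin_ext f y"
  by (rule poly_mapping_eqI) (simp add: lookup_lin_ext lookup_add pairing_add)

lemma lin_ext_scale: "lin_ext f (scale c x) = scale c (lin_ext f x)"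
  by (rule poly_mapping_eqI) (simp add: lookup_lin_ext pairing_scale)

lemma lin_ext_diff: "lin_ext f (x - y) = lin_ext f x - lin_ext f y"
  by (rule poly_mapping_eqI) (simp add: lookup_lin_ext lookup_minus pairing_diff)

lemma lin_ext_basis [simp]: "lin_ext f (basis \<pi>) = f \<pi>"
  by (rule poly_mapping_eqI) (simp add: lookup_lin_ext)

lemma lin_ext_cong:
  "(\<And>\<pi>. \<pi> \<in> Poly_Mapping.keys x \<Longrightarrow> f \<pi> = g \<pi>) \<Longrightarrow> lin_ext f x = lin_ext g x"
  by (simp add: lin_ext_def)

lemma basis_expansion:
  "x = (\<Sum>\<pi>\<in>Poly_Mapping.keys x. scale (Poly_Mapping.lookup x \<pi>) (basis \<pi>))"
  by (rule poly_mapping_eqI)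
     (auto simp: lookup_sum lookup_basis if_distrib sum.delta in_keys_iff cong: if_cong)

lemma vec_induct [consumes 1, case_names zero basis add scale]:
  assumes "Poly_Mapping.keys x \<subseteq> A"
    and "Q 0" and basis: "\<And>\<pi>. \<pi> \<in> A \<Longrightarrow> Q (basis \<pi>)"
    and "\<And>x y. Q x \<Longrightarrow> Q y \<Longrightarrow> Q (x + y)"
    and "\<And>c x. Q x \<Longrightarrow> Q (scale c x)"
  shows "Q x"
proof -
  have "Q (\<Sum>\<pi>\<in>S. scale (Poly_Mapping.lookup x \<pi>) (basis \<pi>))" if "finite S" "S \<subseteq> A" for S
    using that by (induction S rule: finite_induct) (auto intro!: assms)
  then show ?thesis
    by (subst basis_expansion) (simp add: assms(1))
qed

lemma pairing_lin_ext: "pairing g (lin_ext f x) = pairing (\<lambda>\<pi>. pairing g (f \<pi>)) x"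
  by (induction x rule: vec_induct[OF subset_UNIV])
     (simp_all add: lin_ext_add pairing_add lin_ext_scale pairing_scale)

lemma lin_ext_lin_ext: "lin_ext g (lin_ext f x) = lin_ext (\<lambda>\<pi>. lin_ext g (f \<pi>)) x"
  by (rule poly_mapping_eqI) (simp add: lookup_lin_ext pairing_lin_ext)

section \<open>Subspaces of vectors\<close>

definition is_subspace :: "vec set \<Rightarrow> bool" where
  "is_subspace U \<longleftrightarrow> 0 \<in> U \<and> (\<forall>x\<in>U. \<forall>y\<in>U. x + y \<in> U) \<and> (\<forall>c. \<forall>x\<in>U. scale c x \<in> U)"

lemma is_subspace_zero: "is_subspace U \<Longrightarrow> 0 \<in> U"
  and is_subspace_add: "is_subspace U \<Longrightarrow> x \<in> U \<Longrightarrow> y \<in> U \<Longrightarrow> x + y \<in> U"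
  and is_subspace_scale: "is_subspace U \<Longrightarrow> x \<in> U \<Longrightarrow> scale c x \<in> U"
  by (auto simp: is_subspace_def)

lemma is_subspace_uminus: "is_subspace U \<Longrightarrow> x \<in> U \<Longrightarrow> - x \<in> U"
  using is_subspace_scale[of U x "- 1"] by (simp add: scale_minus_1)

lemma is_subspace_diff: "is_subspace U \<Longrightarrow> x \<in> U \<Longrightarrow> y \<in> U \<Longrightarrow> x - y \<in> U"
  using is_subspace_add[of U x "- y"] by (simp add: is_subspace_uminus)

lemma is_subspace_supported: "is_subspace {x. Poly_Mapping.keys x \<subseteq> A}"
proof -
  have "Poly_Mapping.keys (scale c x) \<subseteq> Poly_Mapping.keys x" for c x
    by (auto simp: in_keys_iff)
  then show ?thesis
    unfolding is_subspace_def using keys_add by fastforce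
qed

lemma is_subspace_P_space: "is_subspace (P_space n)"
  and is_subspace_V_space: "is_subspace (V_space n)"
  unfolding P_space_def V_space_def by (rule is_subspace_supported)+

lemma lin_ext_in_subspace:
  assumes "is_subspace U" "Poly_Mapping.keys x \<subseteq> A" "\<And>\<pi>. \<pi> \<in> A \<Longrightarrow> f \<pi> \<in> U"
  shows "lin_ext f x \<in> U"
  using assms(2)
  by (induction x rule: vec_induct)
     (auto simp: lin_ext_add lin_ext_scale assms is_subspace_zero is_subspace_add is_subspace_scale)

lemma V_space_subset_P_space: "V_space n \<subseteq> P_space n"
  by (auto simp: V_space_def P_space_def NC_def)

lemma basis_in_P_space [simp]: "basis \<pi> \<in> P_space n \<longleftrightarrow> \<pi> \<in> set_partitions n"
  and basis_in_V_space [simp]: "basis \<pi> \<in> V_space n \<longleftrightarrow> \<pi> \<in> NC n"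
  by (auto simp: P_space_def V_space_def)

section \<open>Actions of the symmetric group\<close>

lemma adj_permutes: "i \<in> {1..<n} \<Longrightarrow> adj i permutes {1..n}"
  by (rule permutes_swap_id) auto

text \<open>(a, b+1) is (a, b) conjugated by the adjacent transposition of b and b+1, so the upper
  entry can be lowered until the transposition is itself adjacent. Phrasing this as closure of
  \<open>Q\<close> under left multiplication makes it usable as an induction step.\<close>

lemma transpose_adj_induct:
  assumes step: "\<And>i w. i \<in> {1..<n} \<Longrightarrow> Q w \<Longrightarrow> Q (adj i \<circ> w)"
    and "1 \<le> a" "a < b" "b \<le> n" "Q w"
  shows "Q (transpose a b \<circ> w)"
  using \<open>a < b\<close> \<open>b \<le> n\<close> \<open>Q w\<close>
proof (induction b arbitrary: w)
  case (Suc b)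
  show ?case
  proof (cases "a = b")
    case True
    with Suc.prems \<open>1 \<le> a\<close> have "Q (adj b \<circ> w)" by (intro step) auto
    with True show ?thesis by metis
  next
    case False
    with Suc.prems have ab: "a < b" "b \<in> {1..<n}" by auto
    then have "Q (adj b \<circ> (transpose a b \<circ> (adj b \<circ> w)))"
      using Suc by (intro step Suc.IH) auto
    moreover have "adj b \<circ> (transpose a b \<circ> (adj b \<circ> w)) = transpose a (Suc b) \<circ> w"
      using ab by (auto simp: fun_eq_iff transpose_def)
    ultimately show ?thesis by metis
  qed
qed auto

lemma permutes_adj_induct [consumes 1, case_names id adj]:
  assumes "w permutes {1..n}"
    and id: "Q id"
    and step: "\<And>i w. i \<in> {1..<n} \<Longrightarrow> w permutes {1..n} \<Longrightarrow> Q w \<Longrightarrow> Q (adj i \<circ> w)"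
  shows "Q w"
proof -
  have "w permutes {1..n} \<and> Q w"
    using \<open>w permutes {1..n}\<close> finite_atLeastAtMost
  proof (induction w rule: permutes_induct)
    case (swap a b p)
    have step': "adj i \<circ> w permutes {1..n} \<and> Q (adj i \<circ> w)"
      if "i \<in> {1..<n}" "w permutes {1..n} \<and> Q w" for i w
      using that by (blast intro: step permutes_compose adj_permutes)
    have swap': "transpose a b \<circ> p permutes {1..n} \<and> Q (transpose a b \<circ> p)" if "a < b" "1 \<le> a" "b \<le> n" for a b
      by (rule transpose_adj_induct[where n = n and Q = "\<lambda>w. w permutes {1..n} \<and> Q w", OF step'])
         (use swap that in auto)
    show ?case
      using swap' swap(1-3) by (metis atLeastAtMost_iff nat_neq_iff transpose_commute)
  qed (rule conjI[OF permutes_id id])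
  then show ?thesis by simp
qed

text \<open>The inverse of \<open>f w\<close> is \<open>f (inv' w)\<close>. The restriction appears
  because the elements of \<open>BijGroup E\<close> are extensional functions on
  \<open>E\<close>.\<close>

lemma group_action_symI:
  assumes closed: "\<And>w x. w permutes {1..n} \<Longrightarrow> x \<in> E \<Longrightarrow> f w x \<in> E"
    and comp: "\<And>u w x. u permutes {1..n} \<Longrightarrow> w permutes {1..n} \<Longrightarrow> x \<in> E \<Longrightarrow> f (u \<circ> w) x = f u (f w x)"
    and id: "\<And>x. x \<in> E \<Longrightarrow> f id x = x"
  shows "group_action (sym_group n) E (\<lambda>w. restrict (f w) E)"
proof -
  have bij: "bij_betw (restrict (f w) E) E E" if w: "w permutes {1..n}" for w
  proof (rule bij_betwI[where g = "f (inv' w)"])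
    have w': "inv' w permutes {1..n}" by (rule permutes_inv[OF w])
    show "restrict (f w) E \<in> E \<rightarrow> E" "f (inv' w) \<in> E \<rightarrow> E"
      using closed w w' by auto
    show "f (inv' w) (restrict (f w) E x) = x" if "x \<in> E" for x
      using comp[OF w' w that] id that permutes_inv_o[OF w] by simp
    show "restrict (f w) E (f (inv' w) x) = x" if "x \<in> E" for x
      using comp[OF w w' that] id that permutes_inv_o[OF w] closed[OF w' that] by simp
  qed
  have "restrict (f (u \<circ> w)) E = compose E (restrict (f u) E) (restrict (f w) E)"
    if "u permutes {1..n}" "w permutes {1..n}" for u w
    using that comp closed by (auto simp: fun_eq_iff compose_def)
  with bij have "(\<lambda>w. restrict (f w) E) \<in> hom (sym_group n) (BijGroup E)"
    by (auto simp: hom_def BijGroup_def Bij_def sym_group_def)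
  then show ?thesis
    by (simp add: group_action_def group_hom_def group_hom_axioms_def group_BijGroup sym_group_is_group)
qed

lemma group_action_sym_compose:
  assumes "group_action (sym_group n) E \<phi>" "u permutes {1..n}" "w permutes {1..n}" "x \<in> E"
  shows "\<phi> (u \<circ> w) x = \<phi> u (\<phi> w x)"
  using group_action.composition_rule[OF assms(1,4), of u w] assms(2,3)
  by (simp add: sym_group_carrier sym_group_mult)

text \<open>The chosen action exists because \<open>f\<close> is a witness, and it agrees with
  \<open>f\<close> at every permutation because both agree at the generating adjacent
  transpositions. In this way both actions of the theorem are replaced by explicit formulas.\<close>

lemma gen_action_eq:
  assumes closed: "\<And>w x. w permutes {1..n} \<Longrightarrow> x \<in> E \<Longrightarrow> f w x \<in> E"
    and comp: "\<And>u w x. u permutes {1..n} \<Longrightarrow> w permutes {1..n} \<Longrightarrow> x \<in> E \<Longrightarrow> f (u \<circ> w) x = f u (f w x)"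
    and id: "\<And>x. x \<in> E \<Longrightarrow> f id x = x"
    and gen: "\<And>i x. i \<in> {1..<n} \<Longrightarrow> x \<in> E \<Longrightarrow> f (adj i) x = T i x"
    and "w permutes {1..n}" "x \<in> E"
  shows "gen_action n E T w x = f w x"
proof -
  let ?P = "\<lambda>\<phi>. group_action (sym_group n) E \<phi> \<and> (\<forall>i\<in>{1..<n}. \<forall>x\<in>E. \<phi> (adj i) x = T i x)"
  have "?P (\<lambda>w. restrict (f w) E)"
    using group_action_symI[of n E f] closed comp id gen by auto
  then have P: "?P (gen_action n E T)"
    unfolding gen_action_def by (rule someI[of ?P])
  then interpret group_action "sym_group n" E "gen_action n E T" by blast
  show ?thesis
    using \<open>w permutes {1..n}\<close>
  proof (induction w rule: permutes_adj_induct)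
    case id
    show ?case
      using id_eq_one \<open>x \<in> E\<close> assms(3) by (metis restrict_apply' sym_group_one)
  next
    case (adj i w)
    note i = adj_permutes[OF adj(1)] and fwx = closed[OF adj(2) \<open>x \<in> E\<close>]
    have "gen_action n E T (adj i \<circ> w) x = gen_action n E T (adj i) (f w x)"
      using group_action_sym_compose[OF group_action_axioms i adj(2) \<open>x \<in> E\<close>] adj(3) by metis
    also have "\<dots> = f (adj i) (f w x)"
      using P gen adj(1) fwx by metis
    finally show ?case
      using comp[OF i adj(2) \<open>x \<in> E\<close>] by metis
  qed
qed

section \<open>Set partitions and link forms\<close>

lemma set_partitionsD:
  assumes "\<pi> \<in> set_partitions n"
  shows "finite \<pi>" "\<And>B. B \<in> \<pi> \<Longrightarrow> B \<subseteq> {1..n}" "\<And>B. B \<in> \<pi> \<Longrightarrow> finite B"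
    "\<And>B. B \<in> \<pi> \<Longrightarrow> B \<noteq> {}" "\<And>A B x. A \<in> \<pi> \<Longrightarrow> B \<in> \<pi> \<Longrightarrow> x \<in> A \<Longrightarrow> x \<in> B \<Longrightarrow> A = B"
    "\<Union>\<pi> = {1..n}"
proof -
  have *: "partition_on {1..n} \<pi>" using assms by (simp add: set_partitions_def)
  show "finite \<pi>" using finite_elements[OF _ *] by simp
  show un: "\<Union>\<pi> = {1..n}" using partition_onD1[OF *] by simp
  then show sub: "B \<subseteq> {1..n}" if "B \<in> \<pi>" for B using that by auto
  show "finite B" if "B \<in> \<pi>" for B using sub[OF that] by (rule finite_subset) simp
  show "B \<noteq> {}" if "B \<in> \<pi>" for B using partition_onD3[OF *] that by auto
  show "A = B" if "A \<in> \<pi>" "B \<in> \<pi>" "x \<in> A" "x \<in> B" for A B x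
    using partition_onD2[OF *] that by (auto simp: disjoint_def)
qed

lemma set_partitionsI:
  assumes "\<Union>\<pi> = {1..n}" "\<And>A B x. A \<in> \<pi> \<Longrightarrow> B \<in> \<pi> \<Longrightarrow> x \<in> A \<Longrightarrow> x \<in> B \<Longrightarrow> A = B" "{} \<notin> \<pi>"
  shows "\<pi> \<in> set_partitions n"
proof -
  have "disjoint \<pi>"
    unfolding disjoint_def using assms(2) by blast
  with assms(1,3) show ?thesis
    by (simp add: set_partitions_def partition_on_def)
qed

lemma perm_part_compose: "perm_part (u \<circ> w) \<pi> = perm_part u (perm_part w \<pi>)"
  by (simp add: perm_part_def image_image image_comp)

lemma perm_part_id [simp]: "perm_part id \<pi> = \<pi>"
  by (simp add: perm_part_def)

lemma perm_part_in_set_partitions: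
  assumes w: "w permutes {1..n}" and \<pi>: "\<pi> \<in> set_partitions n"
  shows "perm_part w \<pi> \<in> set_partitions n"
proof (rule set_partitionsI)
  show "\<Union> (perm_part w \<pi>) = {1..n}"
    using set_partitionsD(6)[OF \<pi>] permutes_image[OF w] by (auto simp: perm_part_def image_Union[symmetric])
  show "{} \<notin> perm_part w \<pi>"
    using set_partitionsD(4)[OF \<pi>] by (auto simp: perm_part_def)
  show "A = B" if AB: "A \<in> perm_part w \<pi>" "B \<in> perm_part w \<pi>" "x \<in> A" "x \<in> B" for A B x
  proof -
    from AB obtain A' B' where "A' \<in> \<pi>" "B' \<in> \<pi>" "A = w ` A'" "B = w ` B'"
      by (auto simp: perm_part_def)
    with AB show ?thesis
      using set_partitionsD(5)[OF \<pi>, of A' B'] permutes_inj[OF w] by (auto dest!: injD)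
  qed
qed

section \<open>Cores and link determinants\<close>

definition nonsingletons :: "setpart \<Rightarrow> setpart" where
  "nonsingletons \<pi> = {B \<in> \<pi>. card B \<noteq> 1}"

definition core :: "setpart \<Rightarrow> nat set" where
  "core \<pi> = \<Union>(nonsingletons \<pi>)"

definition linked :: "setpart \<Rightarrow> nat \<Rightarrow> nat \<Rightarrow> bool" where
  "linked \<pi> a b \<longleftrightarrow> (\<exists>B\<in>\<pi>. a \<in> B \<and> b \<in> B)"

lemma nonsingletons_perm_part:
  "inj w \<Longrightarrow> nonsingletons (perm_part w \<pi>) = (`) w ` nonsingletons \<pi>"
  by (auto simp: nonsingletons_def perm_part_def card_image inj_on_subset)

lemma core_perm_part: "inj w \<Longrightarrow> core (perm_part w \<pi>) = w ` core \<pi>"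
  by (simp add: core_def nonsingletons_perm_part image_Union)

lemma card_nonsingletons_perm_part:
  "inj w \<Longrightarrow> card (nonsingletons (perm_part w \<pi>)) = card (nonsingletons \<pi>)"
  by (simp add: nonsingletons_perm_part card_image inj_on_def inj_image_eq_iff)

lemma linked_perm_part: "inj w \<Longrightarrow> linked (perm_part w \<pi>) (w a) (w b) \<longleftrightarrow> linked \<pi> a b"
  by (auto simp: linked_def perm_part_def inj_image_mem_iff)

lemma finite_core: "\<pi> \<in> set_partitions n \<Longrightarrow> finite (core \<pi>)"
  using set_partitionsD(1,3) by (auto simp: core_def nonsingletons_def)

text \<open>Turns the case distinction in \<open>star_gen\<close> into membership of i and i+1 in
  the core, which is what the inversion sign of an adjacent transposition detects.\<close>

lemma in_core_iff:
  assumes "\<pi> \<in> set_partitions n" "i \<in> {1..n}"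
  shows "i \<in> core \<pi> \<longleftrightarrow> {i} \<notin> \<pi>"
proof
  assume "i \<in> core \<pi>"
  then obtain B where "B \<in> \<pi>" "card B \<noteq> 1" "i \<in> B"
    by (auto simp: core_def nonsingletons_def)
  then show "{i} \<notin> \<pi>"
    using set_partitionsD(5)[OF assms(1), of B "{i}" i] by auto
next
  assume "{i} \<notin> \<pi>"
  have "i \<in> \<Union>\<pi>" using set_partitionsD(6)[OF assms(1)] assms(2) by simp
  then obtain B where "B \<in> \<pi>" "i \<in> B" by blast
  with \<open>{i} \<notin> \<pi>\<close> show "i \<in> core \<pi>"
    by (auto simp: core_def nonsingletons_def card_1_singleton_iff)
qed

text \<open>Leibniz formula. Rows and columns are selected by functions, so that relabelling the
  points by w is composition with w.\<close>

definition link_det :: "nat \<Rightarrow> (nat \<Rightarrow> nat) \<Rightarrow> (nat \<Rightarrow> nat) \<Rightarrow> setpart \<Rightarrow> rat" where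
  "link_det k s t \<pi> = (\<Sum>\<sigma> | \<sigma> permutes {..<k}.
     of_int (sign \<sigma>) * (\<Prod>i<k. of_bool (linked \<pi> (s i) (t (\<sigma> i)))))"

text \<open>The prescribed core fixes the sign of the action on the support of the form; the
  prescribed k forces each nonsingleton block to contain exactly one row point whenever the
  determinant is nonzero.\<close>

definition link_form :: "nat set \<Rightarrow> nat \<Rightarrow> (nat \<Rightarrow> nat) \<Rightarrow> (nat \<Rightarrow> nat) \<Rightarrow> setpart \<Rightarrow> rat" where
  "link_form N k s t \<pi> =
     (if core \<pi> = N \<and> card (nonsingletons \<pi>) = k then link_det k s t \<pi> else 0)"

text \<open>Row and column points are kept disjoint because the identity behind the skein relation
  holds only off the diagonal; see \<open>link_minor_skein\<close>.\<close>

definition skein_kernel :: "nat \<Rightarrow> vec set" where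
  "skein_kernel n = {x \<in> P_space n. \<forall>N k s t.
     s ` {..<k} \<inter> t ` {..<k} = {} \<longrightarrow> pairing (link_form N k s t) x = 0}"

lemma is_subspace_skein_kernel: "is_subspace (skein_kernel n)"
  using is_subspace_P_space[of n]
  unfolding is_subspace_def skein_kernel_def by (simp add: pairing_add pairing_scale)

lemma link_form_perm_part:
  assumes "inj w"
  shows "link_form (w ` N) k (w \<circ> s) (w \<circ> t) (perm_part w \<pi>) = link_form N k s t \<pi>"
  using assms
  by (simp add: link_form_def link_det_def core_perm_part card_nonsingletons_perm_part
      linked_perm_part inj_image_eq_iff)

section \<open>The sign-twisted action\<close>

text \<open>The sign is a product over unordered pairs, so that it is a cocycle factor by factor.\<close>

definition pair_sign :: "(nat \<Rightarrow> nat) \<Rightarrow> nat set \<Rightarrow> rat" where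
  "pair_sign w Q = (if \<forall>a\<in>Q. \<forall>b\<in>Q. a < b \<longrightarrow> w a < w b then 1 else - 1)"

definition inversion_sign :: "(nat \<Rightarrow> nat) \<Rightarrow> nat set \<Rightarrow> rat" where
  "inversion_sign w N = (\<Prod>Q | Q \<subseteq> N \<and> card Q = 2. pair_sign w Q)"

lemma pair_sign_compose:
  assumes "inj u" "inj w" "card Q = 2"
  shows "pair_sign (u \<circ> w) Q = pair_sign u (w ` Q) * pair_sign w Q"
proof -
  obtain a b where Q: "Q = {a, b}" "a < b"
    using \<open>card Q = 2\<close> by (metis card_2_iff insert_commute linorder_neqE_nat)
  have "w a \<noteq> w b" "u (w a) \<noteq> u (w b)"
    using assms Q by (auto dest!: injD)
  with Q show ?thesis
    by (auto simp: pair_sign_def)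
qed

lemma inversion_sign_compose:
  assumes "inj u" "inj w"
  shows "inversion_sign (u \<circ> w) N = inversion_sign u (w ` N) * inversion_sign w N"
proof -
  have "bij_betw ((`) w) {Q. Q \<subseteq> N \<and> card Q = 2} {Q. Q \<subseteq> w ` N \<and> card Q = 2}"
  proof (rule bij_betwI')
    fix R assume "R \<in> {Q. Q \<subseteq> w ` N \<and> card Q = 2}"
    then obtain Q where "Q \<subseteq> N" "R = w ` Q" by (auto simp: subset_image_iff)
    with \<open>R \<in> _\<close> show "\<exists>Q\<in>{Q. Q \<subseteq> N \<and> card Q = 2}. R = w ` Q"
      using \<open>inj w\<close> by (auto simp: card_image inj_on_subset)
  qed (use \<open>inj w\<close> in \<open>auto simp: inj_image_eq_iff card_image inj_on_subset\<close>)
  then have "inversion_sign u (w ` N) = (\<Prod>Q | Q \<subseteq> N \<and> card Q = 2. pair_sign u (w ` Q))"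
    unfolding inversion_sign_def by (rule prod.reindex_bij_betw[symmetric])
  then show ?thesis
    unfolding inversion_sign_def prod.distrib[symmetric]
    by (auto intro!: prod.cong simp: prod.distrib[symmetric] pair_sign_compose assms)
qed

lemma inversion_sign_id [simp]: "inversion_sign id N = 1"
  by (simp add: inversion_sign_def pair_sign_def)

lemma pair_sign_adj:
  assumes "card Q = 2"
  shows "pair_sign (adj i) Q = (if Q = {i, Suc i} then - 1 else 1)"
proof -
  obtain a b where Q: "Q = {a, b}" "a < b"
    using \<open>card Q = 2\<close> by (metis card_2_iff insert_commute linorder_neqE_nat)
  then have "Q = {i, Suc i} \<longleftrightarrow> a = i \<and> b = Suc i"
    by (auto simp: doubleton_eq_iff)
  with Q show ?thesis
    by (auto simp: pair_sign_def transpose_def)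
qed

lemma inversion_sign_adj:
  assumes "finite N"
  shows "inversion_sign (adj i) N = (if i \<in> N \<and> Suc i \<in> N then - 1 else 1)"
proof -
  have "inversion_sign (adj i) N
      = (\<Prod>Q | Q \<subseteq> N \<and> card Q = 2. if Q = {i, Suc i} then - 1 else 1)"
    unfolding inversion_sign_def by (rule prod.cong) (simp_all add: pair_sign_adj)
  also have "\<dots> = (if i \<in> N \<and> Suc i \<in> N then - 1 else 1)"
    using assms by (subst prod.delta) (auto intro: finite_subset[of _ "Pow N"])
  finally show ?thesis .
qed

definition star_map :: "(nat \<Rightarrow> nat) \<Rightarrow> vec \<Rightarrow> vec" where
  "star_map w = lin_ext (\<lambda>\<pi>. scale (inversion_sign w (core \<pi>)) (basis (perm_part w \<pi>)))"

lemma star_map_basis: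
  "star_map w (basis \<pi>) = scale (inversion_sign w (core \<pi>)) (basis (perm_part w \<pi>))"
  by (simp add: star_map_def)

text \<open>The cocycle identity for the sign applies because the core of w(\<pi>) is the image
  under w of the core of \<pi>.\<close>

lemma star_map_compose:
  assumes "inj u" "inj w"
  shows "star_map (u \<circ> w) x = star_map u (star_map w x)"
  unfolding star_map_def lin_ext_lin_ext
  using assms
  by (simp add: lin_ext_scale inversion_sign_compose perm_part_compose core_perm_part mult.commute)

lemma star_map_id: "star_map id x = x"
  using basis_expansion[of x] by (simp add: star_map_def lin_ext_def)

lemma star_map_P_space:
  assumes "w permutes {1..n}" "x \<in> P_space n"
  shows "star_map w x \<in> P_space n"
  unfolding star_map_def
proof (rule lin_ext_in_subspace[OF is_subspace_P_space])
  show "Poly_Mapping.keys x \<subseteq> set_partitions n"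
    using assms(2) by (simp add: P_space_def)
qed (rule is_subspace_scale[OF is_subspace_P_space],
     simp only: basis_in_P_space perm_part_in_set_partitions[OF assms(1)])

lemma star_gen_eq:
  assumes "i \<in> {1..<n}" "\<pi> \<in> set_partitions n"
  shows "star_gen i \<pi> = star_map (adj i) (basis \<pi>)"
  using assms in_core_iff[OF assms(2), of i] in_core_iff[OF assms(2), of "Suc i"]
  by (auto simp: star_gen_def star_map_basis inversion_sign_adj finite_core scale_minus_1)

lemma star_map_adj:
  assumes "i \<in> {1..<n}" "x \<in> P_space n"
  shows "star_map (adj i) x = lin_ext (star_gen i) x"
proof -
  have "star_map (adj i) x = lin_ext (\<lambda>\<pi>. star_map (adj i) (basis \<pi>)) x"
    by (simp add: star_map_def)
  also have "\<dots> = lin_ext (star_gen i) x"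
    by (rule lin_ext_cong) (use assms star_gen_eq in \<open>auto simp: P_space_def\<close>)
  finally show ?thesis .
qed

lemma star_eq_star_map:
  assumes "w permutes {1..n}" "x \<in> P_space n"
  shows "star n w x = star_map w x"
  unfolding star_def
  by (rule gen_action_eq[OF _ _ _ _ assms])
     (rule star_map_P_space star_map_compose star_map_id star_map_adj permutes_inj | assumption)+

text \<open>Pulling a form back along w gives a scalar multiple of another form: the support of the
  latter has a fixed core, hence a fixed sign.\<close>

lemma star_map_skein_kernel:
  assumes w: "w permutes {1..n}" and x: "x \<in> skein_kernel n"
  shows "star_map w x \<in> skein_kernel n"
proof -
  have "pairing (link_form N k s t) (star_map w x) = 0"
    if disj: "s ` {..<k} \<inter> t ` {..<k} = {}" for N k s t
  proof -
    define v where "v = inv' w"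
    have v: "w \<circ> v = id" "inj v"
      using permutes_inv_o(1)[OF w] permutes_inj[OF permutes_inv[OF w]] by (simp_all add: v_def)
    have wv: "w (v a) = a" for a
      using v(1) by (metis comp_apply id_apply)
    define g where "g = link_form (v ` N) k (v \<circ> s) (v \<circ> t)"
    have "link_form N k s t (perm_part w \<pi>) = g \<pi>" for \<pi>
      using link_form_perm_part[OF permutes_inj[OF w], of "v ` N" k "v \<circ> s" "v \<circ> t" \<pi>]
      by (simp add: g_def image_image wv comp_def)
    \<comment> \<open>\<open>g\<close> vanishes unless the core of \<pi> is the image of N under v,
      so the sign may be replaced by its value there.\<close>
    moreover have "inversion_sign w (core \<pi>) * g \<pi> = inversion_sign w (v ` N) * g \<pi>" for \<pi>
      by (simp add: g_def link_form_def)
    ultimately have "inversion_sign w (core \<pi>) * link_form N k s t (perm_part w \<pi>)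
        = inversion_sign w (v ` N) * g \<pi>" for \<pi>
      by metis
    then have "pairing (link_form N k s t) (star_map w x)
        = pairing (\<lambda>\<pi>. inversion_sign w (v ` N) * g \<pi>) x"
      by (simp add: star_map_def pairing_lin_ext pairing_scale)
    also have "\<dots> = inversion_sign w (v ` N) * pairing g x"
      by (simp add: pairing_def sum_distrib_left mult_ac)
    also have "pairing g x = 0"
    proof -
      have "(v \<circ> s) ` {..<k} \<inter> (v \<circ> t) ` {..<k} = {}"
        unfolding image_comp[symmetric] image_Int[OF \<open>inj v\<close>, symmetric] using disj by simp
      with x show ?thesis by (auto simp: skein_kernel_def g_def)
    qed
    finally show ?thesis by simp
  qed
  with star_map_P_space[OF w] x show ?thesis
    by (auto simp: skein_kernel_def)
qed

section \<open>The skein relation\<close>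

lemma block_eqI: "\<pi> \<in> set_partitions n \<Longrightarrow> B \<in> \<pi> \<Longrightarrow> i \<in> B \<Longrightarrow> block i \<pi> = B"
  unfolding block_def using set_partitionsD(5) by (intro the_equality) blast+

lemma block_mem:
  assumes "\<pi> \<in> set_partitions n" "i \<in> {1..n}"
  shows "block i \<pi> \<in> \<pi>" "i \<in> block i \<pi>"
proof -
  have "i \<in> \<Union>\<pi>" using set_partitionsD(6)[OF assms(1)] assms(2) by simp
  then obtain B where "B \<in> \<pi>" "i \<in> B" by blast
  with block_eqI[OF assms(1) this] show "block i \<pi> \<in> \<pi>" "i \<in> block i \<pi>" by simp_all
qed

lemma linked_iff:
  assumes "\<pi> \<in> set_partitions n" "B \<in> \<pi>" "a \<in> B"
  shows "linked \<pi> a b \<longleftrightarrow> b \<in> B"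
  using assms set_partitionsD(5)[OF assms(1)] unfolding linked_def by blast

section \<open>Expansion of link determinants and the identity for their minors\<close>

definition link_minor :: "setpart \<Rightarrow> nat \<Rightarrow> nat \<Rightarrow> nat \<Rightarrow> nat \<Rightarrow> rat" where
  "link_minor \<pi> a b c d = of_bool (linked \<pi> a c) * of_bool (linked \<pi> b d)
     - of_bool (linked \<pi> a d) * of_bool (linked \<pi> b c)"

text \<open>Expansion along two rows, each term being paired with its composition with \<open>(p q)\<close>.\<close>

lemma link_det_minors:
  assumes pq: "p < k" "q < k" "p \<noteq> q"
  shows "2 * link_det k s t \<pi> = (\<Sum>\<sigma> | \<sigma> permutes {..<k}. of_int (sign \<sigma>) *
     (\<Prod>i\<in>{..<k} - {p, q}. of_bool (linked \<pi> (s i) (t (\<sigma> i)))) *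
     link_minor \<pi> (s p) (s q) (t (\<sigma> p)) (t (\<sigma> q)))"
proof -
  define f :: "(nat \<Rightarrow> nat) \<Rightarrow> rat" where
    "f \<sigma> = of_int (sign \<sigma>) * (\<Prod>i<k. of_bool (linked \<pi> (s i) (t (\<sigma> i))))" for \<sigma>
  define R :: "(nat \<Rightarrow> nat) \<Rightarrow> rat" where
    "R \<sigma> = (\<Prod>i\<in>{..<k} - {p, q}. of_bool (linked \<pi> (s i) (t (\<sigma> i))))" for \<sigma>
  have split: "(\<Prod>i<k. g i) = g p * g q * (\<Prod>i\<in>{..<k} - {p, q}. g i)" for g :: "nat \<Rightarrow> rat"
  proof -
    have "(\<Prod>i<k. g i) = g p * (\<Prod>i\<in>{..<k} - {p}. g i)"
      using pq by (intro prod.remove) auto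
    also have "(\<Prod>i\<in>{..<k} - {p}. g i) = g q * (\<Prod>i\<in>{..<k} - {p} - {q}. g i)"
      using pq by (intro prod.remove) auto
    also have "{..<k} - {p} - {q} = {..<k} - {p, q}" by auto
    finally show ?thesis by (simp only: mult.assoc)
  qed
  have tr: "transpose p q permutes {..<k}"
    using pq by (intro permutes_swap_id) auto
  have f_transpose: "f (\<sigma> \<circ> transpose p q) = - of_int (sign \<sigma>) * R \<sigma> *
      (of_bool (linked \<pi> (s p) (t (\<sigma> q))) * of_bool (linked \<pi> (s q) (t (\<sigma> p))))"
    if "\<sigma> permutes {..<k}" for \<sigma>
  proof -
    have "sign (\<sigma> \<circ> transpose p q) = sign \<sigma> * sign (transpose p q)"
      by (rule sign_compose[OF permutes_imp_permutation[OF finite_lessThan that]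
            permutes_imp_permutation[OF finite_lessThan tr]])
    also have "\<dots> = - sign \<sigma>"
      using pq(3) by (simp add: sign_swap_id)
    finally have "sign (\<sigma> \<circ> transpose p q) = - sign \<sigma>" .
    moreover have "R (\<sigma> \<circ> transpose p q) = R \<sigma>"
      unfolding R_def by (rule prod.cong) (auto simp: transpose_def)
    moreover have "f (\<sigma> \<circ> transpose p q) = of_int (sign (\<sigma> \<circ> transpose p q)) *
        (of_bool (linked \<pi> (s p) (t (\<sigma> q))) * of_bool (linked \<pi> (s q) (t (\<sigma> p))) * R (\<sigma> \<circ> transpose p q))"
      unfolding f_def R_def by (subst split) simp
    ultimately show ?thesis by (simp only: of_int_minus mult_ac)
  qed
  have f_split: "f \<sigma> = of_int (sign \<sigma>) * R \<sigma> *
      (of_bool (linked \<pi> (s p) (t (\<sigma> p))) * of_bool (linked \<pi> (s q) (t (\<sigma> q))))" for \<sigma>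
    unfolding f_def R_def by (subst split) (simp only: mult_ac)
  have "2 * link_det k s t \<pi> = (\<Sum>\<sigma> | \<sigma> permutes {..<k}. f \<sigma> + f (\<sigma> \<circ> transpose p q))"
    unfolding link_det_def sum.distrib f_def[symmetric]
    using sum_permutations_compose_right[OF tr, of f] by simp
  also have "\<dots> = (\<Sum>\<sigma> | \<sigma> permutes {..<k}. of_int (sign \<sigma>) * R \<sigma> *
      link_minor \<pi> (s p) (s q) (t (\<sigma> p)) (t (\<sigma> q)))"
  proof (rule sum.cong)
    fix \<sigma> assume "\<sigma> \<in> {\<sigma>. \<sigma> permutes {..<k}}"
    then show "f \<sigma> + f (\<sigma> \<circ> transpose p q) = of_int (sign \<sigma>) * R \<sigma> *
      link_minor \<pi> (s p) (s q) (t (\<sigma> p)) (t (\<sigma> q))"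
      by (simp only: f_transpose mem_Collect_eq)
         (simp add: f_split link_minor_def algebra_simps)
  qed simp
  finally show ?thesis by (simp only: R_def)
qed

lemma link_det_eq_0:
  assumes "p < k" "q < k" "p \<noteq> q" "\<And>x. linked \<pi> (s p) x \<longleftrightarrow> linked \<pi> (s q) x"
  shows "link_det k s t \<pi> = 0"
  using link_det_minors[OF assms(1-3), of s t \<pi>] by (simp add: link_minor_def assms(4))

text \<open>A nonzero Leibniz term links every \<open>s i\<close> to some
  \<open>t (\<sigma> i)\<close>, a different point by disjointness, so the block of
  \<open>s i\<close> is no singleton. Two row points in one block would give equal rows. Hence the k
  rows meet k different nonsingleton blocks, which are all of them.\<close>

lemma link_det_nonzero:
  assumes \<pi>: "\<pi> \<in> set_partitions n" and k: "card (nonsingletons \<pi>) = k"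
    and disj: "s ` {..<k} \<inter> t ` {..<k} = {}" and nz: "link_det k s t \<pi> \<noteq> 0"
  obtains \<sigma> where "\<sigma> permutes {..<k}" "\<forall>i<k. linked \<pi> (s i) (t (\<sigma> i))"
    "\<forall>i<k. s i \<in> block (s i) \<pi>"
    "bij_betw (\<lambda>i. block (s i) \<pi>) {..<k} (nonsingletons \<pi>)"
proof -
  obtain \<sigma> where \<sigma>: "\<sigma> permutes {..<k}"
    and "of_int (sign \<sigma>) * (\<Prod>i<k. of_bool (linked \<pi> (s i) (t (\<sigma> i)))) \<noteq> (0::rat)"
    using nz unfolding link_det_def by (metis (mono_tags, lifting) mem_Collect_eq sum.neutral)
  then have linked: "linked \<pi> (s i) (t (\<sigma> i))" if "i < k" for i
    using that by auto
  have block: "block (s i) \<pi> \<in> nonsingletons \<pi>" "s i \<in> block (s i) \<pi>" if "i < k" for i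
  proof -
    obtain B where B: "B \<in> \<pi>" "s i \<in> B" "t (\<sigma> i) \<in> B"
      using linked[OF \<open>i < k\<close>] by (auto simp: linked_def)
    have "\<sigma> i < k"
      using permutes_in_image[OF \<sigma>, of i] that by simp
    then have "s i \<noteq> t (\<sigma> i)"
      using disj that by blast
    then have "card B \<noteq> 1"
      using B by (auto simp: card_1_singleton_iff)
    with B block_eqI[OF \<pi> B(1,2)] show "block (s i) \<pi> \<in> nonsingletons \<pi>" "s i \<in> block (s i) \<pi>"
      by (simp_all add: nonsingletons_def)
  qed
  have inj: "inj_on (\<lambda>i. block (s i) \<pi>) {..<k}"
  proof (rule inj_onI, rule ccontr)
    fix p q assume pq: "p \<in> {..<k}" "q \<in> {..<k}" "block (s p) \<pi> = block (s q) \<pi>" "p \<noteq> q"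
    have "linked \<pi> (s p) x \<longleftrightarrow> linked \<pi> (s q) x" for x
      using pq block[of p] block[of q] linked_iff[OF \<pi>, of "block (s p) \<pi>"]
      by (simp add: nonsingletons_def)
    with link_det_eq_0[of p k q \<pi> s t] pq nz show False by simp
  qed
  have fin: "finite (nonsingletons \<pi>)"
    using set_partitionsD(1)[OF \<pi>] by (simp add: nonsingletons_def)
  have "(\<lambda>i. block (s i) \<pi>) ` {..<k} = nonsingletons \<pi>"
    using block(1) card_image[OF inj] k fin by (intro card_subset_eq) auto
  with inj have "bij_betw (\<lambda>i. block (s i) \<pi>) {..<k} (nonsingletons \<pi>)"
    by (simp add: bij_betw_def)
  with \<sigma> linked block(2) show thesis
    by (intro that[of \<sigma>] allI impI)
qed

text \<open>A nonvanishing determinant puts exactly one row point into each nonsingleton block,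
  hence exactly two into X \<union> Y. This union is common to all partitions in a skein relation,
  so their determinants vanish together when the count differs from two.\<close>

lemma link_det_two_blocks:
  assumes \<pi>: "R \<union> {X, Y} \<in> set_partitions n" and k: "card (nonsingletons (R \<union> {X, Y})) = k"
    and disj: "s ` {..<k} \<inter> t ` {..<k} = {}"
    and XY: "card X \<noteq> 1" "card Y \<noteq> 1" "X \<noteq> Y"
    and card: "card {i. i < k \<and> s i \<in> X \<union> Y} \<noteq> 2"
  shows "link_det k s t (R \<union> {X, Y}) = 0"
proof (rule ccontr)
  let ?\<pi> = "R \<union> {X, Y}"
  let ?f = "\<lambda>i. block (s i) ?\<pi>"
  assume "link_det k s t ?\<pi> \<noteq> 0"
  then obtain \<sigma> where "\<sigma> permutes {..<k}" "\<forall>i<k. linked ?\<pi> (s i) (t (\<sigma> i))"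
    and \<sigma>: "\<forall>i<k. s i \<in> ?f i" "bij_betw ?f {..<k} (nonsingletons ?\<pi>)"
    by (rule link_det_nonzero[OF \<pi> k disj])
  let ?I = "{i. i < k \<and> s i \<in> X \<union> Y}"
  have "?f ` ?I = {X, Y}"
  proof
    show "?f ` ?I \<subseteq> {X, Y}"
    proof
      fix Z assume "Z \<in> ?f ` ?I"
      then obtain i where "s i \<in> X \<or> s i \<in> Y" "Z = ?f i" by blast
      with block_eqI[OF \<pi>, of X "s i"] block_eqI[OF \<pi>, of Y "s i"] show "Z \<in> {X, Y}" by auto
    qed
    show "{X, Y} \<subseteq> ?f ` ?I"
    proof
      fix Z assume Z: "Z \<in> {X, Y}"
      then have "Z \<in> nonsingletons ?\<pi>" using XY by (auto simp: nonsingletons_def)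
      then have "Z \<in> ?f ` {..<k}"
        using bij_betw_imp_surj_on[OF \<sigma>(2)] by simp
      then obtain i where i: "i < k" "Z = ?f i" by blast
      with \<sigma>(1) have "s i \<in> Z" by simp
      with i Z show "Z \<in> ?f ` ?I" by blast
    qed
  qed
  moreover have "inj_on ?f ?I"
    by (rule inj_on_subset[OF bij_betw_imp_inj_on[OF \<sigma>(2)]]) auto
  ultimately have "card ?I = card {X, Y}" using card_image[of ?f ?I] by argo
  with card XY(3) show False by simp
qed

lemma linked_Un2:
  "linked (R \<union> {X, Y}) a b \<longleftrightarrow> linked R a b \<or> a \<in> X \<and> b \<in> X \<or> a \<in> Y \<and> b \<in> Y"
  by (auto simp: linked_def)

text \<open>Each row of a link matrix is a sum of the indicators \<open>I\<close>, \<open>J\<close>,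
  \<open>P\<close>, \<open>Q\<close> of {i}, {j}, A, B, so the five minors become quadratic in the
  values of these at c and d. On expansion everything cancels except products in which i, or j,
  occurs both as a row and as a column. The conditions on c and d kill these, in the form
  \<open>I0\<close> and \<open>J0\<close>.\<close>

lemma link_minor_skein:
  assumes "i \<noteq> j" "A \<inter> B = {}" "i \<notin> A" "i \<notin> B" "j \<notin> A" "j \<notin> B"
    and R: "\<And>C. C \<in> R \<Longrightarrow> C \<inter> ({i, j} \<union> A \<union> B) = {}"
    and ab: "a \<in> {i, j} \<union> A \<union> B" "b \<in> {i, j} \<union> A \<union> B"
    and cd: "c \<notin> {a, b}" "d \<notin> {a, b}"
  shows "link_minor (R \<union> {{i} \<union> A, {j} \<union> B}) a b c d + link_minor (R \<union> {{j} \<union> A, {i} \<union> B}) a b c d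
     + link_minor (R \<union> {{i, j}, A \<union> B}) a b c d - link_minor (R \<union> {{i, j} \<union> A, B}) a b c d
     - link_minor (R \<union> {{i, j} \<union> B, A}) a b c d = 0"
proof -
  let ?\<pi>0 = "R \<union> {{i} \<union> A, {j} \<union> B}" and ?\<pi>1 = "R \<union> {{j} \<union> A, {i} \<union> B}"
    and ?\<pi>2 = "R \<union> {{i, j}, A \<union> B}" and ?\<pi>3 = "R \<union> {{i, j} \<union> A, B}"
    and ?\<pi>4 = "R \<union> {{i, j} \<union> B, A}"
  define I J P Q :: "nat \<Rightarrow> rat" where defs: "I x = of_bool (x = i)" "J x = of_bool (x = j)"
    "P x = of_bool (x \<in> A)" "Q x = of_bool (x \<in> B)" for x
  have notB: "x \<in> A \<Longrightarrow> x \<notin> B" for x using assms(2) by auto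
  have R0: "\<not> linked R x y" if "x \<in> {i, j} \<union> A \<union> B" for x y
    using R that by (auto simp: linked_def)
  have row0: "of_bool (linked ?\<pi>0 x y) = I y + P y"
    "of_bool (linked ?\<pi>1 x y) = I y + Q y"
    "of_bool (linked ?\<pi>2 x y) = I y + J y"
    "of_bool (linked ?\<pi>3 x y) = I y + J y + P y"
    "of_bool (linked ?\<pi>4 x y) = I y + J y + Q y"
    if "x = i" for x y
    using R0[of x y] that assms(1,3-6) unfolding linked_Un2 by (auto simp: defs dest: notB)
  have row1: "of_bool (linked ?\<pi>0 x y) = J y + Q y"
    "of_bool (linked ?\<pi>1 x y) = J y + P y"
    "of_bool (linked ?\<pi>2 x y) = I y + J y"
    "of_bool (linked ?\<pi>3 x y) = I y + J y + P y"
    "of_bool (linked ?\<pi>4 x y) = I y + J y + Q y"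
    if "x = j" for x y
    using R0[of x y] that assms(1,3-6) unfolding linked_Un2 by (auto simp: defs dest: notB)
  have row2: "of_bool (linked ?\<pi>0 x y) = I y + P y"
    "of_bool (linked ?\<pi>1 x y) = J y + P y"
    "of_bool (linked ?\<pi>2 x y) = P y + Q y"
    "of_bool (linked ?\<pi>3 x y) = I y + J y + P y"
    "of_bool (linked ?\<pi>4 x y) = P y"
    if "x \<in> A" for x y
    using R0[of x y] that assms(1,3-6) unfolding linked_Un2 by (auto simp: defs dest: notB)
  have row3: "of_bool (linked ?\<pi>0 x y) = J y + Q y"
    "of_bool (linked ?\<pi>1 x y) = I y + Q y"
    "of_bool (linked ?\<pi>2 x y) = P y + Q y"
    "of_bool (linked ?\<pi>3 x y) = Q y"
    "of_bool (linked ?\<pi>4 x y) = I y + J y + Q y"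
    if "x \<in> B" for x y
    using R0[of x y] that assms(1,3-6) unfolding linked_Un2 by (auto simp: defs dest: notB)
  have I0: "I c = 0" "I d = 0" if "a = i \<or> b = i"
    using cd that by (auto simp: defs)
  have J0: "J c = 0" "J d = 0" if "a = j \<or> b = j"
    using cd that by (auto simp: defs)
  from ab(1) consider "a = i" | "a = j" | "a \<in> A" | "a \<in> B" by blast
  then show ?thesis
  proof cases
    case 1
    note a = row0[OF 1]
    from ab(2) consider "b = i" | "b = j" | "b \<in> A" | "b \<in> B" by blast
    then show ?thesis
    proof cases
      case b: 1
      then show ?thesis
        using 1 unfolding link_minor_def a row0[OF b] by (simp add: algebra_simps I0)
    next
      case b: 2
      then show ?thesis
        using 1 unfolding link_minor_def a row1[OF b] by (simp add: algebra_simps I0 J0)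
    next
      case b: 3
      then show ?thesis
        using 1 unfolding link_minor_def a row2[OF b] by (simp add: algebra_simps I0)
    next
      case b: 4
      then show ?thesis
        using 1 unfolding link_minor_def a row3[OF b] by (simp add: algebra_simps I0)
    qed
  next
    case 2
    note a = row1[OF 2]
    from ab(2) consider "b = i" | "b = j" | "b \<in> A" | "b \<in> B" by blast
    then show ?thesis
    proof cases
      case b: 1
      then show ?thesis
        using 2 unfolding link_minor_def a row0[OF b] by (simp add: algebra_simps I0 J0)
    next
      case b: 2
      then show ?thesis
        using 2 unfolding link_minor_def a row1[OF b] by (simp add: algebra_simps J0)
    next
      case b: 3
      then show ?thesis
        using 2 unfolding link_minor_def a row2[OF b] by (simp add: algebra_simps J0)
    next
      case b: 4
      then show ?thesis
        using 2 unfolding link_minor_def a row3[OF b] by (simp add: algebra_simps J0)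
    qed
  next
    case 3
    note a = row2[OF 3]
    from ab(2) consider "b = i" | "b = j" | "b \<in> A" | "b \<in> B" by blast
    then show ?thesis
    proof cases
      case b: 1
      then show ?thesis
        using 3 unfolding link_minor_def a row0[OF b] by (simp add: algebra_simps I0)
    next
      case b: 2
      then show ?thesis
        using 3 unfolding link_minor_def a row1[OF b] by (simp add: algebra_simps J0)
    next
      case b: 3
      then show ?thesis
        using 3 unfolding link_minor_def a row2[OF b] by (simp add: algebra_simps)
    next
      case b: 4
      then show ?thesis
        using 3 unfolding link_minor_def a row3[OF b] by (simp add: algebra_simps)
    qed
  next
    case 4
    note a = row3[OF 4]
    from ab(2) consider "b = i" | "b = j" | "b \<in> A" | "b \<in> B" by blast
    then show ?thesis
    proof cases
      case b: 1
      then show ?thesis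
        using 4 unfolding link_minor_def a row0[OF b] by (simp add: algebra_simps I0)
    next
      case b: 2
      then show ?thesis
        using 4 unfolding link_minor_def a row1[OF b] by (simp add: algebra_simps J0)
    next
      case b: 3
      then show ?thesis
        using 4 unfolding link_minor_def a row2[OF b] by (simp add: algebra_simps)
    next
      case b: 4
      then show ?thesis
        using 4 unfolding link_minor_def a row3[OF b] by (simp add: algebra_simps)
    qed
  qed
qed

text \<open>The row of a singleton is zero off the diagonal, and two rows from X agree. This
  accounts for the terms dropped from the skein map when A or B has one element.\<close>

lemma link_minor_singleton:
  assumes \<pi>: "\<pi> \<in> set_partitions n" "X \<in> \<pi>" "{y} \<in> \<pi>"
    and ab: "a \<in> X \<union> {y}" "b \<in> X \<union> {y}" and cd: "c \<notin> {a, b}" "d \<notin> {a, b}"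
  shows "link_minor \<pi> a b c d = 0"
proof -
  have "linked \<pi> x z \<longleftrightarrow> z \<in> X" if "x \<in> X" for x z
    using linked_iff[OF \<pi>(1,2) that] .
  moreover have "linked \<pi> y z \<longleftrightarrow> z = y" for z
    using linked_iff[OF \<pi>(1,3), of y z] by simp
  ultimately show ?thesis
    using ab cd by (auto simp: link_minor_def)
qed

lemma nonsingletons_Un2:
  assumes "R \<union> {X, Y} \<in> set_partitions n" "X \<notin> R" "Y \<notin> R" "X \<noteq> Y" "card X \<noteq> 1" "card Y \<noteq> 1"
  shows "core (R \<union> {X, Y}) = core R \<union> (X \<union> Y)"
    "card (nonsingletons (R \<union> {X, Y})) = card (nonsingletons R) + 2"
proof -
  have *: "nonsingletons (R \<union> {X, Y}) = insert X (insert Y (nonsingletons R))"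
    using assms by (auto simp: nonsingletons_def)
  then show "core (R \<union> {X, Y}) = core R \<union> (X \<union> Y)"
    by (auto simp: core_def)
  have "finite (nonsingletons R)"
    using set_partitionsD(1)[OF assms(1)] by (simp add: nonsingletons_def)
  with * show "card (nonsingletons (R \<union> {X, Y})) = card (nonsingletons R) + 2"
    using assms by (simp add: nonsingletons_def)
qed

text \<open>Once the common condition on core and block count is split off, expansion along the two
  rows lying in the blocks being replaced leaves a common cofactor, and the identity for 2-by-2
  minors applies to each summand.\<close>

lemma link_form_skein:
  assumes ij: "i \<noteq> j" "A \<inter> B = {}" "i \<notin> A" "i \<notin> B" "j \<notin> A" "j \<notin> B"
    and ne: "A \<noteq> {}" "B \<noteq> {}"
    and R: "\<And>C. C \<in> R \<Longrightarrow> C \<inter> ({i, j} \<union> A \<union> B) = {}"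
    and part: "R \<union> {{i} \<union> A, {j} \<union> B} \<in> set_partitions n" "R \<union> {{j} \<union> A, {i} \<union> B} \<in> set_partitions n"
      "R \<union> {{i, j}, A \<union> B} \<in> set_partitions n" "R \<union> {{i, j} \<union> A, B} \<in> set_partitions n"
      "R \<union> {{i, j} \<union> B, A} \<in> set_partitions n"
    and disj: "s ` {..<k} \<inter> t ` {..<k} = {}"
  shows "link_form N k s t (R \<union> {{i} \<union> A, {j} \<union> B}) + link_form N k s t (R \<union> {{j} \<union> A, {i} \<union> B})
     + link_form N k s t (R \<union> {{i, j}, A \<union> B})
     - (if card B = 1 then 0 else link_form N k s t (R \<union> {{i, j} \<union> A, B}))
     - (if card A = 1 then 0 else link_form N k s t (R \<union> {{i, j} \<union> B, A})) = 0"
proof -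
  let ?\<pi>0 = "R \<union> {{i} \<union> A, {j} \<union> B}" and ?\<pi>1 = "R \<union> {{j} \<union> A, {i} \<union> B}"
    and ?\<pi>2 = "R \<union> {{i, j}, A \<union> B}" and ?\<pi>3 = "R \<union> {{i, j} \<union> A, B}"
    and ?\<pi>4 = "R \<union> {{i, j} \<union> B, A}"
  let ?U = "{i, j} \<union> A \<union> B"
  let ?d = "link_det k s t"
  have notin: "C \<notin> R" if "C \<subseteq> ?U" "C \<noteq> {}" for C
    using R[of C] that by blast
  obtain a b where a: "a \<in> A" and b: "b \<in> B" using ne by auto
  then have ab: "a \<noteq> b" "a \<noteq> i" "a \<noteq> j" "b \<noteq> i" "b \<noteq> j" using ij by auto
  have cards: "card ({i} \<union> A) \<noteq> 1" "card ({j} \<union> B) \<noteq> 1" "card ({j} \<union> A) \<noteq> 1" "card ({i} \<union> B) \<noteq> 1"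
    "card {i, j} \<noteq> 1" "card (A \<union> B) \<noteq> 1" "card ({i, j} \<union> A) \<noteq> 1" "card ({i, j} \<union> B) \<noteq> 1"
    using ab a b ij by (auto simp: card_1_singleton_iff)
  have neq: "{i} \<union> A \<noteq> {j} \<union> B" "{j} \<union> A \<noteq> {i} \<union> B" "{i, j} \<noteq> A \<union> B" "{i, j} \<union> A \<noteq> B"
    "{i, j} \<union> B \<noteq> A"
    using ij by auto
  define U where "U = {i, j} \<union> A \<union> B"
  have Ueq: "({i} \<union> A) \<union> ({j} \<union> B) = U" "({j} \<union> A) \<union> ({i} \<union> B) = U" "{i, j} \<union> (A \<union> B) = U"
    "({i, j} \<union> A) \<union> B = U" "({i, j} \<union> B) \<union> A = U"
    by (auto simp: U_def)
  have notin_R: "{i} \<union> A \<notin> R" "{j} \<union> B \<notin> R" "{j} \<union> A \<notin> R" "{i} \<union> B \<notin> R" "{i, j} \<notin> R" "A \<union> B \<notin> R"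
    "{i, j} \<union> A \<notin> R" "{i, j} \<union> B \<notin> R" "A \<notin> R" "B \<notin> R"
    using ne by (intro notin; blast)+
  note n0 = nonsingletons_Un2[OF part(1) notin_R(1,2) neq(1) cards(1,2), unfolded Ueq]
  note n1 = nonsingletons_Un2[OF part(2) notin_R(3,4) neq(2) cards(3,4), unfolded Ueq]
  note n2 = nonsingletons_Un2[OF part(3) notin_R(5,6) neq(3) cards(5,6), unfolded Ueq]
  note n3 = nonsingletons_Un2[OF part(4) notin_R(7,10) neq(4) cards(7), unfolded Ueq]
  note n4 = nonsingletons_Un2[OF part(5) notin_R(8,9) neq(5) cards(8), unfolded Ueq]
  \<comment> \<open>Every term whose two replaced blocks are nonsingletons has core
    \<open>core R \<union> U\<close> and two nonsingleton blocks more than R, so one condition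
    decides the case of \<open>link_form\<close> for all of them.\<close>
  let ?C = "core R \<union> U = N \<and> card (nonsingletons R) + 2 = k"
  let ?d3 = "if card B = 1 then 0 else ?d ?\<pi>3" and ?d4 = "if card A = 1 then 0 else ?d ?\<pi>4"
  have f0: "link_form N k s t ?\<pi>0 = (if ?C then ?d ?\<pi>0 else 0)"
    and f1: "link_form N k s t ?\<pi>1 = (if ?C then ?d ?\<pi>1 else 0)"
    and f2: "link_form N k s t ?\<pi>2 = (if ?C then ?d ?\<pi>2 else 0)"
    unfolding link_form_def n0 n1 n2 by (rule refl)+
  have f3: "(if card B = 1 then 0 else link_form N k s t ?\<pi>3) = (if ?C then ?d3 else 0)"
  proof (cases "card B = 1")
    case False
    show ?thesis
      unfolding link_form_def n3[OF False] by (simp only: False if_False)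
  qed simp
  have f4: "(if card A = 1 then 0 else link_form N k s t ?\<pi>4) = (if ?C then ?d4 else 0)"
  proof (cases "card A = 1")
    case False
    show ?thesis
      unfolding link_form_def n4[OF False] by (simp only: False if_False)
  qed simp
  have main: "?d ?\<pi>0 + ?d ?\<pi>1 + ?d ?\<pi>2 - ?d3 - ?d4 = 0" if k: "card (nonsingletons R) + 2 = k"
  proof (cases "card {p. p < k \<and> s p \<in> U} = 2")
    case False
    have "?d ?\<pi>0 = 0"
      by (rule link_det_two_blocks[OF part(1) trans[OF n0(2) k] disj cards(1,2) neq(1)])
         (simp only: Ueq False not_False_eq_True)
    moreover have "?d ?\<pi>1 = 0"
      by (rule link_det_two_blocks[OF part(2) trans[OF n1(2) k] disj cards(3,4) neq(2)])
         (simp only: Ueq False not_False_eq_True)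
    moreover have "?d ?\<pi>2 = 0"
      by (rule link_det_two_blocks[OF part(3) trans[OF n2(2) k] disj cards(5,6) neq(3)])
         (simp only: Ueq False not_False_eq_True)
    moreover have "?d ?\<pi>3 = 0" if B: "card B \<noteq> 1"
      by (rule link_det_two_blocks[OF part(4) trans[OF n3(2)[OF B] k] disj cards(7) B neq(4)])
         (simp only: Ueq False not_False_eq_True)
    moreover have "?d ?\<pi>4 = 0" if A: "card A \<noteq> 1"
      by (rule link_det_two_blocks[OF part(5) trans[OF n4(2)[OF A] k] disj cards(8) A neq(5)])
         (simp only: Ueq False not_False_eq_True)
    ultimately show ?thesis by simp
  next
    case True
    then obtain p q where pq: "{p. p < k \<and> s p \<in> U} = {p, q}" "p \<noteq> q"
      by (meson card_2_iff)
    then have pq': "p < k" "q < k" "s p \<in> U" "s q \<in> U" by blast+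
    have disj': "t x \<noteq> s y" if "x < k" "y < k" for x y
      using disj that by blast
    have st: "t (\<sigma> p) \<notin> {s p, s q}" "t (\<sigma> q) \<notin> {s p, s q}" if \<sigma>: "\<sigma> permutes {..<k}" for \<sigma>
      using permutes_in_image[OF \<sigma>, of p] permutes_in_image[OF \<sigma>, of q] pq'(1,2) disj' by simp_all
    \<comment> \<open>The remaining row points lie outside U, so their entries depend on R only, and
      this factor is the same for all five partitions.\<close>
    define rest :: "(nat \<Rightarrow> nat) \<Rightarrow> rat" where
      "rest \<sigma> = (\<Prod>i\<in>{..<k} - {p, q}. of_bool (linked R (s i) (t (\<sigma> i))))" for \<sigma>
    have expand: "2 * ?d (R \<union> {X, Y}) = (\<Sum>\<sigma> | \<sigma> permutes {..<k}. of_int (sign \<sigma>) * rest \<sigma> *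
        link_minor (R \<union> {X, Y}) (s p) (s q) (t (\<sigma> p)) (t (\<sigma> q)))"
      if XY: "X \<union> Y = U" for X Y
    proof -
      have linked_R: "linked (R \<union> {X, Y}) (s i) x = linked R (s i) x" if i: "i \<in> {..<k} - {p, q}" for i x
      proof -
        have "s i \<notin> X \<union> Y" unfolding XY using i pq(1) by blast
        then show ?thesis unfolding linked_Un2 by blast
      qed
      have "(\<Prod>i\<in>{..<k} - {p, q}. of_bool (linked (R \<union> {X, Y}) (s i) (t (\<sigma> i)))) = rest \<sigma>" for \<sigma>
        unfolding rest_def by (rule prod.cong[OF refl]) (simp only: linked_R)
      then show ?thesis
        unfolding link_det_minors[OF pq'(1,2) pq(2)] by simp
    qed
    \<comment> \<open>A dropped term has determinant 0 here, so it may be put back and the full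
      five-term identity used.\<close>
    have zero3: "?d ?\<pi>3 = 0" if "card B = 1"
    proof -
      from \<open>card B = 1\<close> obtain y where y: "B = {y}" by (auto simp: card_1_singleton_iff)
      have "link_minor ?\<pi>3 (s p) (s q) (t (\<sigma> p)) (t (\<sigma> q)) = 0" if \<sigma>: "\<sigma> permutes {..<k}" for \<sigma>
        by (rule link_minor_singleton[OF part(4), of "{i, j} \<union> A" y])
           (use pq'(3,4) st[OF \<sigma>] y in \<open>auto simp: U_def\<close>)
      then have "2 * ?d ?\<pi>3 = 0"
        unfolding expand[OF Ueq(4)] by (intro sum.neutral) simp
      then show ?thesis by simp
    qed
    have zero4: "?d ?\<pi>4 = 0" if "card A = 1"
    proof -
      from \<open>card A = 1\<close> obtain y where y: "A = {y}" by (auto simp: card_1_singleton_iff)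
      have "link_minor ?\<pi>4 (s p) (s q) (t (\<sigma> p)) (t (\<sigma> q)) = 0" if \<sigma>: "\<sigma> permutes {..<k}" for \<sigma>
        by (rule link_minor_singleton[OF part(5), of "{i, j} \<union> B" y])
           (use pq'(3,4) st[OF \<sigma>] y in \<open>auto simp: U_def\<close>)
      then have "2 * ?d ?\<pi>4 = 0"
        unfolding expand[OF Ueq(5)] by (intro sum.neutral) simp
      then show ?thesis by simp
    qed
    have "2 * (?d ?\<pi>0 + ?d ?\<pi>1 + ?d ?\<pi>2 - ?d ?\<pi>3 - ?d ?\<pi>4)
      = (\<Sum>\<sigma> | \<sigma> permutes {..<k}. of_int (sign \<sigma>) * rest \<sigma> *
         (link_minor ?\<pi>0 (s p) (s q) (t (\<sigma> p)) (t (\<sigma> q)) + link_minor ?\<pi>1 (s p) (s q) (t (\<sigma> p)) (t (\<sigma> q))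
         + link_minor ?\<pi>2 (s p) (s q) (t (\<sigma> p)) (t (\<sigma> q)) - link_minor ?\<pi>3 (s p) (s q) (t (\<sigma> p)) (t (\<sigma> q))
         - link_minor ?\<pi>4 (s p) (s q) (t (\<sigma> p)) (t (\<sigma> q))))"
      unfolding distrib_left right_diff_distrib sum.distrib sum_subtractf expand[OF Ueq(1)] expand[OF Ueq(2)]
        expand[OF Ueq(3)] expand[OF Ueq(4)] expand[OF Ueq(5)]
      by (rule refl)
    also have "\<dots> = 0"
    proof (rule sum.neutral, rule ballI)
      fix \<sigma> assume "\<sigma> \<in> {\<sigma>. \<sigma> permutes {..<k}}"
      then have \<sigma>: "\<sigma> permutes {..<k}" by simp
      show "of_int (sign \<sigma>) * rest \<sigma> *
         (link_minor ?\<pi>0 (s p) (s q) (t (\<sigma> p)) (t (\<sigma> q)) + link_minor ?\<pi>1 (s p) (s q) (t (\<sigma> p)) (t (\<sigma> q))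
         + link_minor ?\<pi>2 (s p) (s q) (t (\<sigma> p)) (t (\<sigma> q)) - link_minor ?\<pi>3 (s p) (s q) (t (\<sigma> p)) (t (\<sigma> q))
         - link_minor ?\<pi>4 (s p) (s q) (t (\<sigma> p)) (t (\<sigma> q))) = 0"
        using link_minor_skein[OF ij R pq'(3,4)[unfolded U_def] st[OF \<sigma>]] by simp
    qed
    finally show ?thesis
      using zero3 zero4 by auto
  qed
  show ?thesis
    unfolding f0 f1 f2 f3 f4 using main by auto
qed

section \<open>Noncrossing partitions\<close>

text \<open>An ordered relation: the least of the four points lies in C. Facts about a pair of
  blocks are therefore stated for both orders.\<close>

definition crossing :: "nat set \<Rightarrow> nat set \<Rightarrow> bool" where
  "crossing C D \<longleftrightarrow> (\<exists>a b c d. a < b \<and> b < c \<and> c < d \<and> a \<in> C \<and> c \<in> C \<and> b \<in> D \<and> d \<in> D)"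

lemma crossingI:
  "a < b \<Longrightarrow> b < c \<Longrightarrow> c < d \<Longrightarrow> a \<in> C \<Longrightarrow> c \<in> C \<Longrightarrow> b \<in> D \<Longrightarrow> d \<in> D \<Longrightarrow> crossing C D"
  unfolding crossing_def by blast

lemma crossingE:
  assumes "crossing C D"
  obtains a b c d where "a < b" "b < c" "c < d" "a \<in> C" "c \<in> C" "b \<in> D" "d \<in> D"
  using assms unfolding crossing_def by blast

lemma noncrossing_iff: "noncrossing \<pi> \<longleftrightarrow> (\<forall>C\<in>\<pi>. \<forall>D\<in>\<pi>. C \<noteq> D \<longrightarrow> \<not> crossing C D)"
proof
  assume nc: "noncrossing \<pi>"
  show "\<forall>C\<in>\<pi>. \<forall>D\<in>\<pi>. C \<noteq> D \<longrightarrow> \<not> crossing C D"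
  proof (intro ballI impI notI)
    fix C D assume CD: "C \<in> \<pi>" "D \<in> \<pi>" "C \<noteq> D" "crossing C D"
    from CD(4) obtain a b c d
      where "a < b" "b < c" "c < d" "a \<in> C" "c \<in> C" "b \<in> D" "d \<in> D" by (rule crossingE)
    with nc CD(1-3) show False unfolding noncrossing_def by metis
  qed
next
  assume "\<forall>C\<in>\<pi>. \<forall>D\<in>\<pi>. C \<noteq> D \<longrightarrow> \<not> crossing C D"
  then show "noncrossing \<pi>"
    unfolding noncrossing_def by (metis crossingI)
qed

lemma noncrossingD: "noncrossing \<pi> \<Longrightarrow> C \<in> \<pi> \<Longrightarrow> D \<in> \<pi> \<Longrightarrow> C \<noteq> D \<Longrightarrow> \<not> crossing C D"
  by (simp add: noncrossing_iff)

lemma crossing_mono: "crossing C D \<Longrightarrow> C \<subseteq> C' \<Longrightarrow> D \<subseteq> D' \<Longrightarrow> crossing C' D'"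
  unfolding crossing_def by blast

text \<open>In a < b < c < d all three consecutive comparisons are between a point of C and a point
  of D; the order inside C or inside D does not matter. This admits adjacent transpositions and the
  collapse of i and i+1 as f.\<close>

lemma crossing_image:
  assumes "crossing C D"
    and "\<And>x y. x \<in> C \<Longrightarrow> y \<in> D \<Longrightarrow> x < y \<Longrightarrow> f x < f y"
    and "\<And>x y. x \<in> C \<Longrightarrow> y \<in> D \<Longrightarrow> y < x \<Longrightarrow> f y < f x"
  shows "crossing (f ` C) (f ` D)"
  using assms(1)
proof (rule crossingE)
  fix a b c d assume *: "a < b" "b < c" "c < d" "a \<in> C" "c \<in> C" "b \<in> D" "d \<in> D"
  show ?thesis
    by (rule crossingI[of "f a" "f b" "f c" "f d"]) (use * assms(2,3) in auto)
qed

text \<open>No point of D separates i from i+1. According to the position of b and d relative to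
  them, one of a, c is dropped in favour of i or i+1, whichever shares a block with the point that
  is kept, which gives a crossing with X or Y alone.\<close>

lemma crossing_merge_left:
  assumes "crossing (X \<union> Y) D" and X: "i \<in> X" and Y: "Suc i \<in> Y" and D: "i \<notin> D" "Suc i \<notin> D"
  shows "crossing X D \<or> crossing Y D \<or> crossing D X \<or> crossing D Y"
  using assms(1)
proof (rule crossingE)
  fix a b c d assume *: "a < b" "b < c" "c < d" "a \<in> X \<union> Y" "c \<in> X \<union> Y" "b \<in> D" "d \<in> D"
  have ne: "b \<noteq> i" "b \<noteq> Suc i" "d \<noteq> i" "d \<noteq> Suc i" using * D by auto
  consider "b < i" "d < i" | "b < i" "Suc i < d" | "Suc i < b"
    using ne * by linarith
  then show ?thesis
  proof cases
    case 1
    then show ?thesis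
      using * X Y crossingI[of b c d i D X] crossingI[of b c d "Suc i" D Y] by auto
  next
    case 2
    then show ?thesis
      using * X Y crossingI[of a b i d X D] crossingI[of a b "Suc i" d Y D] by auto
  next
    case 3
    then show ?thesis
      using * X Y crossingI[of i b c d X D] crossingI[of "Suc i" b c d Y D] by auto
  qed
qed

lemma crossing_merge_right:
  assumes "crossing D (X \<union> Y)" and X: "i \<in> X" and Y: "Suc i \<in> Y" and D: "i \<notin> D" "Suc i \<notin> D"
  shows "crossing X D \<or> crossing Y D \<or> crossing D X \<or> crossing D Y"
  using assms(1)
proof (rule crossingE)
  fix a b c d assume *: "a < b" "b < c" "c < d" "a \<in> D" "c \<in> D" "b \<in> X \<union> Y" "d \<in> X \<union> Y"
  have ne: "a \<noteq> i" "a \<noteq> Suc i" "c \<noteq> i" "c \<noteq> Suc i" using * D by auto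
  consider "c < i" | "a < i" "Suc i < c" | "Suc i < a"
    using ne * by linarith
  then show ?thesis
  proof cases
    case 1
    then show ?thesis
      using * X Y crossingI[of a b c i D X] crossingI[of a b c "Suc i" D Y] by auto
  next
    case 2
    then show ?thesis
      using * X Y crossingI[of a i c d D X] crossingI[of a "Suc i" c d D Y] by auto
  next
    case 3
    then show ?thesis
      using * X Y crossingI[of i a b c X D] crossingI[of "Suc i" a b c Y D] by auto
  qed
qed

text \<open>Merging blocks that contain i and i+1 creates no crossing with the rest, and neither
  does passing to subsets of the merged block. Only X' against Y' remains to be checked.\<close>

lemma noncrossing_resplit:
  assumes nc: "noncrossing (R \<union> {X, Y})" and i: "i \<in> X" "Suc i \<in> Y"
    and R: "\<And>C. C \<in> R \<Longrightarrow> i \<notin> C \<and> Suc i \<notin> C"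
    and sub: "X' \<subseteq> X \<union> Y" "Y' \<subseteq> X \<union> Y"
    and XY': "\<not> crossing X' Y'" "\<not> crossing Y' X'"
  shows "noncrossing (R \<union> {X', Y'})"
proof -
  have RXY: "\<not> crossing X C" "\<not> crossing Y C" "\<not> crossing C X" "\<not> crossing C Y" if "C \<in> R" for C
    using noncrossingD[OF nc] that i R[OF that] by blast+
  have RU: "\<not> crossing (X \<union> Y) C" "\<not> crossing C (X \<union> Y)" if "C \<in> R" for C
    using crossing_merge_left[OF _ i, of C] crossing_merge_right[OF _ i, of C] RXY[OF that] R[OF that]
    by blast+
  have R': "\<not> crossing Z C" "\<not> crossing C Z" if "C \<in> R" "Z \<subseteq> X \<union> Y" for C Z
    using RU[OF that(1)] crossing_mono[of Z C "X \<union> Y" C] crossing_mono[of C Z C "X \<union> Y"] that(2)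
    by blast+
  show ?thesis
    unfolding noncrossing_iff
  proof (intro ballI impI)
    fix C D assume "C \<in> R \<union> {X', Y'}" "D \<in> R \<union> {X', Y'}" "C \<noteq> D"
    then consider "C \<in> R" "D \<in> R" | "C \<in> R" "D \<in> {X', Y'}" | "C \<in> {X', Y'}" "D \<in> R"
      | "C = X'" "D = Y'" | "C = Y'" "D = X'"
      by blast
    then show "\<not> crossing C D"
    proof cases
      case 1
      with noncrossingD[OF nc, of C D] \<open>C \<noteq> D\<close> show ?thesis by blast
    next
      case 2
      then show ?thesis using R'(2)[of C D] sub by blast
    next
      case 3
      then show ?thesis using R'(1)[of D C] sub by blast
    qed (simp_all add: XY')
  qed
qed

lemma not_crossing_adjacent: "\<not> crossing {i, Suc i} Z" "\<not> crossing Z {i, Suc i}"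
  by (auto elim!: crossingE)

lemma not_crossing_singleton: "\<not> crossing {x} Z" "\<not> crossing Z {x}"
  by (auto elim!: crossingE)

text \<open>Sending both i and i+1 to w keeps their order relative to every point of D, since D
  avoids both.\<close>

lemma crossing_collapse:
  assumes "i \<notin> D" "Suc i \<notin> D" and w: "w \<in> {i, Suc i}"
  shows "crossing ({i, Suc i} \<union> C) D \<Longrightarrow> crossing ({w} \<union> C) D"
    and "crossing D ({i, Suc i} \<union> C) \<Longrightarrow> crossing D ({w} \<union> C)"
proof -
  define f where "f x = (if x \<in> {i, Suc i} then w else x)" for x
  have D: "y \<noteq> i \<and> y \<noteq> Suc i" if "y \<in> D" for y using assms that by auto
  have fD: "f ` D = D" using D by (force simp: f_def)
  have fC: "f ` ({i, Suc i} \<union> C) \<subseteq> {w} \<union> C" by (auto simp: f_def)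
  have less: "x < y \<Longrightarrow> f x < f y" "y < x \<Longrightarrow> f y < f x" if "y \<in> D" for x y
    using D[OF that] w by (auto simp: f_def)
  show "crossing ({w} \<union> C) D" if "crossing ({i, Suc i} \<union> C) D"
    using crossing_mono[OF crossing_image[OF that, of f] fC, of D] less fD by blast
  show "crossing D ({w} \<union> C)" if "crossing D ({i, Suc i} \<union> C)"
    using crossing_mono[OF crossing_image[OF that, of f] _ fC, of D] less fD by blast
qed

text \<open>Singletons cross nothing, so two blocks whose images cross both avoid i or both avoid
  i+1. On such blocks the swap preserves the order.\<close>

lemma noncrossing_adj_singleton:
  assumes \<pi>: "\<pi> \<in> set_partitions n" "noncrossing \<pi>" and sing: "{i} \<in> \<pi> \<or> {Suc i} \<in> \<pi>"
  shows "noncrossing (perm_part (adj i) \<pi>)"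
  unfolding noncrossing_iff
proof (intro ballI impI notI)
  fix C' D' assume "C' \<in> perm_part (adj i) \<pi>" "D' \<in> perm_part (adj i) \<pi>" "C' \<noteq> D'" and cr: "crossing C' D'"
  then obtain C D where CD: "C \<in> \<pi>" "D \<in> \<pi>" "C' = adj i ` C" "D' = adj i ` D" "C \<noteq> D"
    by (auto simp: perm_part_def)
  have "C \<noteq> {j}" "D \<noteq> {j}" for j
    using cr CD(3,4) not_crossing_singleton by auto
  then have notin: "i \<notin> C \<and> i \<notin> D \<or> Suc i \<notin> C \<and> Suc i \<notin> D"
    using sing CD(1,2) set_partitionsD(5)[OF \<pi>(1)] by blast
  have "crossing (adj i ` C') (adj i ` D')"
    by (rule crossing_image[OF cr]) (use notin CD(3,4) in \<open>auto simp: transpose_def split: if_splits\<close>)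
  then have "crossing C D"
    by (simp add: CD(3,4) image_comp)
  with noncrossingD[OF \<pi>(2) CD(1,2,5)] show False by simp
qed

text \<open>Otherwise let a and b be further members of the blocks of i and i+1. In each of the six
  relative positions of a, b and the pair i, i+1, either \<pi> or s_i(\<pi>) has a crossing. Thus
  the first case of \<open>tau_gen\<close> occurs only next to a singleton, where
  \<open>star_gen\<close> has sign +1.\<close>

lemma noncrossing_adj_crossing:
  assumes \<pi>: "\<pi> \<in> set_partitions n" "noncrossing \<pi>" "noncrossing (perm_part (adj i) \<pi>)"
    and XY: "X \<in> \<pi>" "Y \<in> \<pi>" "X \<noteq> Y" "i \<in> X" "Suc i \<in> Y"
  shows "X = {i} \<or> Y = {Suc i}"
proof (rule ccontr)
  assume "\<not> ?thesis"
  then obtain a b where ab: "a \<in> X" "a \<noteq> i" "b \<in> Y" "b \<noteq> Suc i"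
    using XY by auto
  have nc: "\<not> crossing X Y" "\<not> crossing Y X"
    using noncrossingD[OF \<pi>(2)] XY by auto
  have "i \<notin> Y" "Suc i \<notin> X"
    using XY set_partitionsD(5)[OF \<pi>(1)] by blast+
  then have ne: "a \<noteq> Suc i" "b \<noteq> i" "a \<noteq> b"
    using ab XY set_partitionsD(5)[OF \<pi>(1)] by auto
  define X' Y' where "X' = adj i ` X" and "Y' = adj i ` Y"
  have "X' \<noteq> Y'"
    using XY(3) by (simp add: X'_def Y'_def inj_image_eq_iff)
  then have nc': "\<not> crossing X' Y'" "\<not> crossing Y' X'"
    using noncrossingD[OF \<pi>(3)] XY by (auto simp: X'_def Y'_def perm_part_def)
  have "adj i i \<in> X'" "adj i a \<in> X'" "adj i (Suc i) \<in> Y'" "adj i b \<in> Y'"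
    using XY ab unfolding X'_def Y'_def by blast+
  then have mem: "Suc i \<in> X'" "a \<in> X'" "i \<in> Y'" "b \<in> Y'"
    using ab ne by (simp_all add: transpose_def)
  consider "Suc i < a" "a < b" | "Suc i < b" "b < a" | "a < b" "b < i" | "b < a" "a < i"
    | "a < i" "Suc i < b" | "b < i" "Suc i < a"
    using ab ne by linarith
  then show False
    by cases (use nc nc' mem XY ab crossingI[of i "Suc i" a b X Y] crossingI[of i "Suc i" b a Y' X']
        crossingI[of a b i "Suc i" X Y] crossingI[of b a i "Suc i" Y' X']
        crossingI[of a i "Suc i" b X' Y'] crossingI[of b i "Suc i" a Y X] in auto)
qed

section \<open>The skein relation modulo the kernel\<close>

lemma set_partitions_resplit:
  assumes "R \<union> {X, Y} \<in> set_partitions n" "\<And>C. C \<in> R \<Longrightarrow> C \<inter> (X \<union> Y) = {}"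
    and "X' \<union> Y' = X \<union> Y" "X' \<inter> Y' = {}" "X' \<noteq> {}" "Y' \<noteq> {}"
  shows "R \<union> {X', Y'} \<in> set_partitions n"
proof (rule set_partitionsI)
  have "\<Union>(R \<union> {X', Y'}) = \<Union>(R \<union> {X, Y})"
    using assms(3) by auto
  then show "\<Union>(R \<union> {X', Y'}) = {1..n}"
    using set_partitionsD(6)[OF assms(1)] by simp
  show "{} \<notin> R \<union> {X', Y'}"
    using set_partitionsD(4)[OF assms(1)] assms(5,6) by blast
  fix A B x assume AB: "A \<in> R \<union> {X', Y'}" "B \<in> R \<union> {X', Y'}" "x \<in> A" "x \<in> B"
  show "A = B"
  proof (cases "x \<in> X \<union> Y")
    case True
    then have "A \<notin> R" "B \<notin> R" using assms(2) AB by blast+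
    with AB assms(4) show ?thesis by blast
  next
    case False
    then have "A \<in> R" "B \<in> R" using assms(3) AB by blast+
    with AB show ?thesis using set_partitionsD(5)[OF assms(1), of A B x] by blast
  qed
qed

lemma perm_part_adj_adj [simp]: "perm_part (adj i) (perm_part (adj i) \<pi>) = \<pi>"
  by (simp add: perm_part_compose[symmetric])

lemma perm_part_adj_split:
  assumes \<pi>: "\<pi> \<in> set_partitions n" and XY: "X \<in> \<pi>" "Y \<in> \<pi>" "i \<in> X" "Suc i \<in> Y"
  shows "X = Y \<Longrightarrow> perm_part (adj i) \<pi> = \<pi>"
    and "X \<noteq> Y \<Longrightarrow> perm_part (adj i) \<pi> =
      (\<pi> - {X, Y}) \<union> {{Suc i} \<union> (X - {i}), {i} \<union> (Y - {Suc i})}"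
proof -
  have fix_R: "adj i ` C = C" if "C \<in> \<pi>" "C \<noteq> X" "C \<noteq> Y" for C
  proof -
    have "i \<notin> C" "Suc i \<notin> C" using that XY set_partitionsD(5)[OF \<pi>] by blast+
    then have "adj i x = x" if "x \<in> C" for x
      using that by (auto simp: transpose_def)
    then show ?thesis by simp
  qed
  have eq: "perm_part (adj i) \<pi> = (\<pi> - {X, Y}) \<union> {adj i ` X, adj i ` Y}"
  proof -
    have "perm_part (adj i) \<pi> = (`) (adj i) ` (\<pi> - {X, Y}) \<union> (`) (adj i) ` {X, Y}"
      unfolding perm_part_def image_Un[symmetric] using XY by (intro arg_cong2[where f = image]) auto
    also have "(`) (adj i) ` (\<pi> - {X, Y}) = (\<lambda>C. C) ` (\<pi> - {X, Y})"
      by (rule image_cong) (auto simp: fix_R)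
    finally show ?thesis by simp
  qed
  show "perm_part (adj i) \<pi> = \<pi>" if "X = Y"
  proof -
    have "adj i ` X = X" using that XY(3,4) by (auto simp: transpose_image_eq)
    with eq that XY show ?thesis by auto
  qed
  show "perm_part (adj i) \<pi> = (\<pi> - {X, Y}) \<union> {{Suc i} \<union> (X - {i}), {i} \<union> (Y - {Suc i})}" if "X \<noteq> Y"
  proof -
    have "i \<notin> Y" "Suc i \<notin> X"
      using XY that set_partitionsD(5)[OF \<pi>] by blast+
    then have "adj i ` X = {Suc i} \<union> (X - {i})" "adj i ` Y = {i} \<union> (Y - {Suc i})"
      using XY by (force simp: transpose_def image_iff)+
    with eq show ?thesis by simp
  qed
qed

lemma skein_at_facts:
  assumes "crosses_at n \<pi> i"
  shows "skein_at i \<pi> \<in> V_space n" "basis \<pi> + skein_at i \<pi> \<in> skein_kernel n"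
proof -
  have \<pi>: "\<pi> \<in> set_partitions n" "\<not> noncrossing \<pi>" "noncrossing (perm_part (adj i) \<pi>)" and i: "i \<in> {1..<n}"
    using assms by (auto simp: crosses_at_def)
  have adj_sp: "perm_part (adj i) \<pi> \<in> set_partitions n"
    by (rule perm_part_in_set_partitions[OF adj_permutes[OF i] \<pi>(1)])
  define X Y where "X = block i \<pi>" and "Y = block (Suc i) \<pi>"
  have XY: "X \<in> \<pi>" "Y \<in> \<pi>" "i \<in> X" "Suc i \<in> Y"
    using block_mem[OF \<pi>(1), of i] block_mem[OF \<pi>(1), of "Suc i"] i by (auto simp: X_def Y_def)
  define A B R where "A = X - {i}" and "B = Y - {Suc i}" and "R = \<pi> - {X, Y}"
  have "X \<noteq> Y"
    using perm_part_adj_split(1)[OF \<pi>(1) XY] \<pi>(2,3) by auto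
  \<comment> \<open>With a singleton at i or i+1, swapping back from s_i(\<pi>) would keep the
    partition noncrossing, although \<pi> is not. This makes A and B nonempty.\<close>
  have "\<not> ({i} \<in> \<pi> \<or> {Suc i} \<in> \<pi>)"
  proof
    assume "{i} \<in> \<pi> \<or> {Suc i} \<in> \<pi>"
    then have "adj i ` {i} \<in> perm_part (adj i) \<pi> \<or> adj i ` {Suc i} \<in> perm_part (adj i) \<pi>"
      unfolding perm_part_def by blast
    then have "noncrossing (perm_part (adj i) (perm_part (adj i) \<pi>))"
      by (intro noncrossing_adj_singleton[OF adj_sp \<pi>(3)]) auto
    with \<pi>(2) show False by simp
  qed
  moreover have "X = {i}" if "A = {}"
    using that XY(3) by (auto simp: A_def)
  moreover have "Y = {Suc i}" if "B = {}"
    using that XY(4) by (auto simp: B_def)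
  ultimately have ne: "A \<noteq> {}" "B \<noteq> {}"
    using XY(1,2) by auto
  have "X \<inter> Y = {}"
    using set_partitionsD(5)[OF \<pi>(1) XY(1,2)] \<open>X \<noteq> Y\<close> by blast
  then have dis: "A \<inter> B = {}" "i \<notin> A" "i \<notin> B" "Suc i \<notin> A" "Suc i \<notin> B"
    using XY by (auto simp: A_def B_def)
  have X: "X = {i} \<union> A" and Y: "Y = {Suc i} \<union> B"
    using XY by (auto simp: A_def B_def)
  have \<pi>_eq: "\<pi> = R \<union> {{i} \<union> A, {Suc i} \<union> B}"
    unfolding X[symmetric] Y[symmetric] using XY(1,2) by (auto simp: R_def)
  have adj_eq: "perm_part (adj i) \<pi> = R \<union> {{Suc i} \<union> A, {i} \<union> B}"
    using perm_part_adj_split(2)[OF \<pi>(1) XY \<open>X \<noteq> Y\<close>] by (simp add: R_def A_def B_def)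
  have R: "C \<inter> ({i, Suc i} \<union> A \<union> B) = {}" if "C \<in> R" for C
  proof -
    have "C \<in> \<pi>" "C \<noteq> X" "C \<noteq> Y" using that by (auto simp: R_def)
    then have "C \<inter> X = {}" "C \<inter> Y = {}"
      using set_partitionsD(5)[OF \<pi>(1), of C] XY(1,2) by blast+
    then show ?thesis unfolding X Y by blast
  qed
  then have R': "C \<inter> (({i} \<union> A) \<union> ({Suc i} \<union> B)) = {}" if "C \<in> R" for C
    using that by blast
  have p0: "R \<union> {{i} \<union> A, {Suc i} \<union> B} \<in> set_partitions n"
    using \<pi>(1) unfolding \<pi>_eq .
  have p1: "R \<union> {{Suc i} \<union> A, {i} \<union> B} \<in> set_partitions n"
    using adj_sp unfolding adj_eq .
  have p2: "R \<union> {{i, Suc i}, A \<union> B} \<in> set_partitions n"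
    by (rule set_partitions_resplit[OF p0 R']) (use dis ne in auto)
  have p3: "R \<union> {{i, Suc i} \<union> A, B} \<in> set_partitions n"
    by (rule set_partitions_resplit[OF p0 R']) (use dis ne in auto)
  have p4: "R \<union> {{i, Suc i} \<union> B, A} \<in> set_partitions n"
    by (rule set_partitions_resplit[OF p0 R']) (use dis ne in auto)
  \<comment> \<open>The block of i is listed first, as \<open>noncrossing_resplit\<close> expects;
    in s_i(\<pi>) it is i that is joined with B, and i+1 with A.\<close>
  have nc1: "noncrossing (R \<union> {{i} \<union> B, {Suc i} \<union> A})"
    using \<pi>(3) unfolding adj_eq by (simp add: insert_commute)
  have mem: "{i} \<union> B \<in> R \<union> {{i} \<union> B, {Suc i} \<union> A}" "{Suc i} \<union> A \<in> R \<union> {{i} \<union> B, {Suc i} \<union> A}"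
    by simp_all
  have BA: "{i} \<union> B \<noteq> {Suc i} \<union> A"
    using dis by auto
  have nAB: "\<not> crossing ({i} \<union> B) ({Suc i} \<union> A)" "\<not> crossing ({Suc i} \<union> A) ({i} \<union> B)"
    using noncrossingD[OF nc1 mem BA] noncrossingD[OF nc1 mem(2,1) BA[symmetric]] .
  have Ri: "i \<notin> C \<and> Suc i \<notin> C" if "C \<in> R" for C using R[OF that] by blast
  note resplit = noncrossing_resplit[OF nc1 _ _ Ri]
  have nc2: "noncrossing (R \<union> {{i, Suc i}, A \<union> B})"
    by (rule resplit) (use not_crossing_adjacent in auto)
  \<comment> \<open>Collapsing i and i+1 to i+1 turns the first block into the block of s_i(\<pi>)
    around A, while B lies in its other block. For \<open>nc4\<close> the collapse goes to
    i.\<close>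
  have nc3: "noncrossing (R \<union> {{i, Suc i} \<union> A, B})"
  proof (rule resplit)
    show "\<not> crossing ({i, Suc i} \<union> A) B"
      using crossing_collapse(1)[of i B "Suc i" A] 
        crossing_mono[of "{Suc i} \<union> A" B "{Suc i} \<union> A" "{i} \<union> B"] nAB dis by auto
    show "\<not> crossing B ({i, Suc i} \<union> A)"
      using crossing_collapse(2)[of i B "Suc i" A] 
        crossing_mono[of B "{Suc i} \<union> A" "{i} \<union> B" "{Suc i} \<union> A"] nAB dis by auto
  qed auto
  have nc4: "noncrossing (R \<union> {{i, Suc i} \<union> B, A})"
  proof (rule resplit)
    show "\<not> crossing ({i, Suc i} \<union> B) A"
      using crossing_collapse(1)[of i A i B] 
        crossing_mono[of "{i} \<union> B" A "{i} \<union> B" "{Suc i} \<union> A"] nAB dis by auto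
    show "\<not> crossing A ({i, Suc i} \<union> B)"
      using crossing_collapse(2)[of i A i B] 
        crossing_mono[of A "{i} \<union> B" "{Suc i} \<union> A" "{i} \<union> B"] nAB dis by auto
  qed auto
  have skein_eq: "skein_at i \<pi> = basis (R \<union> {{Suc i} \<union> A, {i} \<union> B}) + basis (R \<union> {{i, Suc i}, A \<union> B})
      - (if card B = 1 then 0 else basis (R \<union> {{i, Suc i} \<union> A, B}))
      - (if card A = 1 then 0 else basis (R \<union> {{i, Suc i} \<union> B, A}))"
    unfolding skein_at_def Let_def X_def[symmetric] Y_def[symmetric] A_def[symmetric] B_def[symmetric]
      R_def[symmetric] adj_eq by (rule refl)
  have NC: "R \<union> {{Suc i} \<union> A, {i} \<union> B} \<in> NC n" "R \<union> {{i, Suc i}, A \<union> B} \<in> NC n"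
      "R \<union> {{i, Suc i} \<union> A, B} \<in> NC n" "R \<union> {{i, Suc i} \<union> B, A} \<in> NC n"
    using p1 p2 p3 p4 \<pi>(3) nc2 nc3 nc4 unfolding adj_eq NC_def by blast+
  note V = is_subspace_V_space[of n]
  show skein_V: "skein_at i \<pi> \<in> V_space n"
    unfolding skein_eq using NC
    by (intro is_subspace_diff[OF V] is_subspace_add[OF V])
       (use is_subspace_zero[OF V] in auto)
  have "pairing (link_form N k s t) (basis \<pi> + skein_at i \<pi>) = 0"
    if disj: "s ` {..<k} \<inter> t ` {..<k} = {}" for N k s t
  proof -
    have if0: "pairing f (if b then 0 else basis \<rho>) = (if b then 0 else f \<rho>)" for f b \<rho>
      by simp
    show ?thesis
      using link_form_skein[OF _ dis(1,2,3,4,5) ne R p0 p1 p2 p3 p4 disj, of N, folded \<pi>_eq]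
      unfolding pairing_add skein_eq pairing_diff if0 pairing_basis by simp
  qed
  moreover have "basis \<pi> + skein_at i \<pi> \<in> P_space n"
    using skein_V V_space_subset_P_space[of n] \<pi>(1) by (intro is_subspace_add[OF is_subspace_P_space]) auto
  ultimately show "basis \<pi> + skein_at i \<pi> \<in> skein_kernel n"
    by (simp add: skein_kernel_def)
qed

text \<open>Both facts hold at every crossing index, hence at the chosen one. Once V(n) and the
  kernel are known to meet only in 0, they also show that the value does not depend on the
  index.\<close>

lemma skein_facts:
  assumes "almost_noncrossing n \<pi>"
  shows "skein n \<pi> \<in> V_space n" "basis \<pi> + skein n \<pi> \<in> skein_kernel n"
proof -
  have "crosses_at n \<pi> (SOME i. crosses_at n \<pi> i)"
    using assms unfolding almost_noncrossing_def by (rule someI_ex)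
  from skein_at_facts[OF this] show "skein n \<pi> \<in> V_space n" "basis \<pi> + skein n \<pi> \<in> skein_kernel n"
    by (simp_all only: skein_def)
qed

text \<open>If i and i+1 share a block, both operators give -\<pi>. If they do not and s_i(\<pi>) is
  noncrossing, a singleton is involved and both give s_i(\<pi>). Otherwise -s_i(\<pi>) is congruent
  to the skein value of s_i(\<pi>).\<close>

lemma tau_gen_facts:
  assumes \<pi>: "\<pi> \<in> NC n" and i: "i \<in> {1..<n}"
  shows "tau_gen n i \<pi> \<in> V_space n" "star_gen i \<pi> - tau_gen n i \<pi> \<in> skein_kernel n"
proof -
  have sp: "\<pi> \<in> set_partitions n" and nc: "noncrossing \<pi>" using \<pi> by (auto simp: NC_def)
  define X Y \<rho> where "X = block i \<pi>" and "Y = block (Suc i) \<pi>" and "\<rho> = perm_part (adj i) \<pi>"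
  have XY: "X \<in> \<pi>" "Y \<in> \<pi>" "i \<in> X" "Suc i \<in> Y"
    using block_mem[OF sp, of i] block_mem[OF sp, of "Suc i"] i by (auto simp: X_def Y_def)
  have \<rho>: "\<rho> \<in> set_partitions n"
    unfolding \<rho>_def by (rule perm_part_in_set_partitions[OF adj_permutes[OF i] sp])
  note zero = is_subspace_zero[OF is_subspace_skein_kernel]
  have "tau_gen n i \<pi> \<in> V_space n \<and> star_gen i \<pi> - tau_gen n i \<pi> \<in> skein_kernel n"
  proof (cases "X = Y")
    case True
    then have "{i} \<notin> \<pi>" "{Suc i} \<notin> \<pi>"
      using XY set_partitionsD(5)[OF sp, of X] by (metis n_not_Suc_n singletonD singletonI)+
    then have "star_gen i \<pi> = - basis \<pi>"
      using perm_part_adj_split(1)[OF sp XY True] by (simp add: star_gen_def)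
    moreover have "tau_gen n i \<pi> = - basis \<pi>"
      using True by (simp add: tau_gen_def X_def Y_def)
    ultimately show ?thesis
      using \<pi> zero is_subspace_uminus[OF is_subspace_V_space] by simp
  next
    case False
    show ?thesis
    proof (cases "noncrossing \<rho>")
      case True
      have "{i} \<in> \<pi> \<or> {Suc i} \<in> \<pi>"
        using noncrossing_adj_crossing[OF sp nc True[unfolded \<rho>_def] XY(1,2) False XY(3,4)] XY by auto
      then have "star_gen i \<pi> = basis \<rho>"
        by (auto simp: star_gen_def \<rho>_def)
      moreover have "tau_gen n i \<pi> = basis \<rho>"
        using True False by (simp add: tau_gen_def X_def Y_def \<rho>_def)
      ultimately show ?thesis
        using True \<rho> zero by (simp add: NC_def)
    next
      case crossing: False
      have "\<not> ({i} \<in> \<pi> \<or> {Suc i} \<in> \<pi>)"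
        using noncrossing_adj_singleton[OF sp nc] crossing by (auto simp: \<rho>_def)
      then have star: "star_gen i \<pi> = - basis \<rho>"
        by (simp add: star_gen_def \<rho>_def)
      have tau: "tau_gen n i \<pi> = skein n \<rho>"
        using crossing False by (simp add: tau_gen_def X_def Y_def \<rho>_def)
      have "crosses_at n \<rho> i"
        using \<rho> crossing i nc by (simp add: crosses_at_def \<rho>_def)
      then have "almost_noncrossing n \<rho>"
        by (auto simp: almost_noncrossing_def)
      note facts = skein_facts[OF this]
      have "- (basis \<rho> + skein n \<rho>) \<in> skein_kernel n"
        by (rule is_subspace_uminus[OF is_subspace_skein_kernel facts(2)])
      then show ?thesis
        using facts(1) by (simp add: star tau)
    qed
  qed
  then show "tau_gen n i \<pi> \<in> V_space n" "star_gen i \<pi> - tau_gen n i \<pi> \<in> skein_kernel n"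
    by simp_all
qed

section \<open>Independence of noncrossing partitions modulo the kernel\<close>

lemma nonsingletonsD:
  assumes \<pi>: "\<pi> \<in> set_partitions n" and B: "B \<in> nonsingletons \<pi>"
  shows "B \<in> \<pi>" "finite B" "B \<noteq> {}" "Min B \<in> B" "Max B \<in> B" "Min B < Max B"
    "block (Min B) \<pi> = B" "B \<subseteq> core \<pi>"
proof -
  show "B \<in> \<pi>" using B by (simp add: nonsingletons_def)
  with \<pi> show fin: "finite B" "B \<noteq> {}"
    using set_partitionsD(3,4) by blast+
  then show mem: "Min B \<in> B" "Max B \<in> B" by simp_all
  show "block (Min B) \<pi> = B"
    by (rule block_eqI[OF \<pi> \<open>B \<in> \<pi>\<close> mem(1)])
  show "B \<subseteq> core \<pi>"
    using B by (auto simp: core_def)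
  show "Min B < Max B"
  proof (rule ccontr)
    assume "\<not> Min B < Max B"
    then have "x = Min B" if "x \<in> B" for x
      using Min_le[OF fin(1) that] Max_ge[OF fin(1) that] by linarith
    then have "B = {Min B}" using mem by blast
    then have "card B = 1" by (metis card_1_singleton_iff One_nat_def)
    with B show False by (simp add: nonsingletons_def)
  qed
qed

lemma nonsingletons_block:
  assumes \<pi>: "\<pi> \<in> set_partitions n" and s: "s \<in> Min ` nonsingletons \<pi>"
  shows "block s \<pi> \<in> nonsingletons \<pi>" "Min (block s \<pi>) = s"
  using s nonsingletonsD(7)[OF \<pi>] by auto

lemma block_in_nonsingletons:
  assumes \<pi>: "\<pi> \<in> set_partitions n" and x: "x \<in> core \<pi>"
  shows "block x \<pi> \<in> nonsingletons \<pi>" "x \<in> block x \<pi>"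
proof -
  obtain B where B: "B \<in> nonsingletons \<pi>" "x \<in> B" using x by (auto simp: core_def)
  then have "block x \<pi> = B"
    using block_eqI[OF \<pi> _ B(2)] by (simp add: nonsingletons_def)
  with B show "block x \<pi> \<in> nonsingletons \<pi>" "x \<in> block x \<pi>" by simp_all
qed

text \<open>Let C be the block of \<pi> with minimum s. Its maximum also closes a block B of \<pi>',
  with minimum r different from s. If s < r, agreement beyond s makes C the block of r in \<pi>,
  contradicting its minimum. If r < s, then r, s, \<open>Max C\<close> and the maximum of the block
  of s in \<pi>' form a crossing in \<pi>'.\<close>

lemma NC_max_not_less:
  assumes \<pi>: "\<pi> \<in> NC n" and \<pi>': "\<pi>' \<in> NC n"
    and mins: "Min ` nonsingletons \<pi> = Min ` nonsingletons \<pi>'"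
    and maxs: "Max ` nonsingletons \<pi> = Max ` nonsingletons \<pi>'"
    and s: "s \<in> Min ` nonsingletons \<pi>"
    and later: "\<And>r. r \<in> Min ` nonsingletons \<pi> \<Longrightarrow> s < r \<Longrightarrow> Max (block r \<pi>) = Max (block r \<pi>')"
  shows "\<not> Max (block s \<pi>) < Max (block s \<pi>')"
proof
  assume less: "Max (block s \<pi>) < Max (block s \<pi>')"
  have sp: "\<pi> \<in> set_partitions n" "\<pi>' \<in> set_partitions n" and nc: "noncrossing \<pi>'"
    using \<pi> \<pi>' by (auto simp: NC_def)
  define C where "C = block s \<pi>"
  have C: "C \<in> nonsingletons \<pi>" "Min C = s"
    using nonsingletons_block[OF sp(1) s] by (simp_all add: C_def)
  then have "Max C \<in> Max ` nonsingletons \<pi>'" using maxs by blast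
  then obtain B where B: "B \<in> nonsingletons \<pi>'" "Max B = Max C" by auto
  define r where "r = Min B"
  have r: "r \<in> Min ` nonsingletons \<pi>" and rB: "block r \<pi>' = B"
    using B mins nonsingletonsD(7)[OF sp(2)] by (auto simp: r_def)
  have "r \<noteq> s"
    using less rB B(2) by (auto simp: C_def)
  have "\<not> s < r"
  proof
    assume "s < r"
    then have "Max (block r \<pi>) = Max C"
      using later[OF r] rB B(2) by simp
    moreover have rb: "block r \<pi> \<in> nonsingletons \<pi>" "Min (block r \<pi>) = r"
      by (rule nonsingletons_block[OF sp(1) r])+
    ultimately have "block r \<pi> = C"
      using set_partitionsD(5)[OF sp(1)] nonsingletonsD(1,5)[OF sp(1) C(1)]
        nonsingletonsD(1,5)[OF sp(1) rb(1)] by metis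
    with rb(2) C(2) \<open>s < r\<close> show False by simp
  qed
  with \<open>r \<noteq> s\<close> have "r < s" by simp
  have D: "block s \<pi>' \<in> nonsingletons \<pi>'" "Min (block s \<pi>') = s"
    by (rule nonsingletons_block[OF sp(2) s[unfolded mins]])+
  have "crossing B (block s \<pi>')"
  proof (rule crossingI)
    show "r < s" by fact
    show "s < Max C" using nonsingletonsD(6)[OF sp(1) C(1)] C(2) by simp
    show "Max C < Max (block s \<pi>')" using less by (simp add: C_def)
    show "r \<in> B" "Max C \<in> B"
      using nonsingletonsD(4,5)[OF sp(2) B(1)] B(2) by (simp_all add: r_def)
    show "s \<in> block s \<pi>'" "Max (block s \<pi>') \<in> block s \<pi>'"
      using nonsingletonsD(4,5)[OF sp(2) D(1)] D(2) by simp_all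
  qed
  moreover have "B \<noteq> block s \<pi>'"
    using D(2) \<open>r < s\<close> by (auto simp: r_def)
  ultimately show False
    using noncrossingD[OF nc] nonsingletonsD(1)[OF sp(2) B(1)] nonsingletonsD(1)[OF sp(2) D(1)] by blast
qed

lemma NC_max_eq:
  assumes \<pi>: "\<pi> \<in> NC n" and \<pi>': "\<pi>' \<in> NC n"
    and mins: "Min ` nonsingletons \<pi> = Min ` nonsingletons \<pi>'"
    and maxs: "Max ` nonsingletons \<pi> = Max ` nonsingletons \<pi>'"
    and s: "s \<in> Min ` nonsingletons \<pi>"
  shows "Max (block s \<pi>) = Max (block s \<pi>')"
  \<comment> \<open>At the largest minimum where the maxima differ, one of the two partitions has a crossing.\<close>
proof (rule ccontr)
  assume ne: "Max (block s \<pi>) \<noteq> Max (block s \<pi>')"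
  define Bad where "Bad = {s \<in> Min ` nonsingletons \<pi>. Max (block s \<pi>) \<noteq> Max (block s \<pi>')}"
  have "finite Bad" "Bad \<noteq> {}"
    using ne s set_partitionsD(1)[of \<pi> n] \<pi> by (auto simp: Bad_def NC_def nonsingletons_def)
  then have m: "Max Bad \<in> Bad" by simp
  have later: "Max (block r \<pi>) = Max (block r \<pi>')"
    if "r \<in> Min ` nonsingletons \<pi>" "Max Bad < r" for r
    using Max_ge[OF \<open>finite Bad\<close>, of r] that by (auto simp: Bad_def)
  have m1: "Max Bad \<in> Min ` nonsingletons \<pi>" "Max (block (Max Bad) \<pi>) \<noteq> Max (block (Max Bad) \<pi>')"
    using m unfolding Bad_def by blast+
  have "\<not> Max (block (Max Bad) \<pi>) < Max (block (Max Bad) \<pi>')"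
    by (rule NC_max_not_less[OF \<pi> \<pi>' mins maxs m1(1) later])
  moreover have "\<not> Max (block (Max Bad) \<pi>') < Max (block (Max Bad) \<pi>)"
    by (rule NC_max_not_less[OF \<pi>' \<pi> mins[symmetric] maxs[symmetric]])
       (use m1(1) mins later in auto)
  ultimately show False using m1(2) by linarith
qed

text \<open>Suppose the block of x starts at m in \<pi> and at r > m in \<pi>'. As maxima over equal
  minima agree, the block of \<pi> with minimum r reaches beyond x, so m, r, x and its maximum form
  a crossing in \<pi>.\<close>

lemma NC_min_not_less:
  assumes \<pi>: "\<pi> \<in> NC n" and \<pi>': "\<pi>' \<in> NC n" and core: "core \<pi> = core \<pi>'"
    and mins: "Min ` nonsingletons \<pi> = Min ` nonsingletons \<pi>'"
    and maxs: "Max ` nonsingletons \<pi> = Max ` nonsingletons \<pi>'"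
    and x: "x \<in> core \<pi>"
  shows "\<not> Min (block x \<pi>) < Min (block x \<pi>')"
proof
  assume less: "Min (block x \<pi>) < Min (block x \<pi>')"
  have sp: "\<pi> \<in> set_partitions n" "\<pi>' \<in> set_partitions n" and nc: "noncrossing \<pi>"
    using \<pi> \<pi>' by (auto simp: NC_def)
  define B B' where "B = block x \<pi>" and "B' = block x \<pi>'"
  have B: "B \<in> nonsingletons \<pi>" "x \<in> B"
    using block_in_nonsingletons[OF sp(1) x] by (simp_all add: B_def)
  have B': "B' \<in> nonsingletons \<pi>'" "x \<in> B'"
    using block_in_nonsingletons[OF sp(2), of x] x core by (simp_all add: B'_def)
  define r where "r = Min B'"
  have r: "r \<in> Min ` nonsingletons \<pi>"
    using B'(1) mins by (simp add: r_def)
  define C where "C = block r \<pi>"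
  have C: "C \<in> nonsingletons \<pi>" "Min C = r"
    using nonsingletons_block[OF sp(1) r] by (simp_all add: C_def)
  have "Max C = Max B'"
    using NC_max_eq[OF \<pi> \<pi>' mins maxs r] nonsingletonsD(7)[OF sp(2) B'(1)] by (simp add: C_def r_def)
  then have rx: "r \<le> x" "x \<le> Max C"
    using B' nonsingletonsD(2)[OF sp(2) B'(1)] by (simp_all add: r_def)
  have "B \<noteq> C"
    using less C(2) by (auto simp: B_def B'_def r_def)
  have "x \<notin> C"
    using \<open>B \<noteq> C\<close> set_partitionsD(5)[OF sp(1)] nonsingletonsD(1)[OF sp(1) C(1)] nonsingletonsD(1)[OF sp(1) B(1)] B(2)
    by blast
  then have "x \<noteq> r" "x \<noteq> Max C"
    using nonsingletonsD(4,5)[OF sp(1) C(1)] C(2) by auto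
  then have "crossing B C"
    using rx less nonsingletonsD(4,5)[OF sp(1) C(1)] nonsingletonsD(4)[OF sp(1) B(1)] C(2) B(2)
    by (intro crossingI[of "Min B" r x "Max C"]) (auto simp: B_def B'_def r_def)
  then show False
    using noncrossingD[OF nc] nonsingletonsD(1)[OF sp(1) B(1)] nonsingletonsD(1)[OF sp(1) C(1)] \<open>B \<noteq> C\<close> by blast
qed

lemma subset_if_same_block_mins:
  assumes sp: "\<pi> \<in> set_partitions n" "\<pi>' \<in> set_partitions n" and core: "core \<pi> = core \<pi>'"
    and eq: "\<And>x. x \<in> core \<pi> \<Longrightarrow> Min (block x \<pi>) = Min (block x \<pi>')"
  shows "\<pi> \<subseteq> \<pi>'"
proof
  fix B assume B: "B \<in> \<pi>"
  show "B \<in> \<pi>'"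
  proof (cases "card B = 1")
    case True
    then obtain x where x: "B = {x}" by (auto simp: card_1_singleton_iff)
    have "x \<in> {1..n}" using set_partitionsD(2)[OF sp(1) B] x by simp
    then show ?thesis
      using in_core_iff[OF sp(1)] in_core_iff[OF sp(2)] core B x by blast
  next
    case False
    with B have nB: "B \<in> nonsingletons \<pi>" by (simp add: nonsingletons_def)
    note B_facts = nonsingletonsD[OF sp(1) nB]
    define B' where "B' = block (Min B) \<pi>'"
    have "Min B \<in> core \<pi>'" using B_facts(4,8) core by blast
    then have B': "B' \<in> nonsingletons \<pi>'" "Min B \<in> B'"
      using block_in_nonsingletons[OF sp(2)] by (simp_all add: B'_def)
    note B'_facts = nonsingletonsD[OF sp(2) B'(1)]
    have min: "Min B' = Min B"
      using eq[of "Min B"] B_facts(4,7,8) by (auto simp: B'_def)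
    have same: "x \<in> B \<longleftrightarrow> x \<in> B'" if x: "x \<in> core \<pi>" for x
    proof -
      have x': "x \<in> core \<pi>'" using x core by simp
      have b: "block x \<pi> \<in> nonsingletons \<pi>" "x \<in> block x \<pi>" "block x \<pi>' \<in> nonsingletons \<pi>'" "x \<in> block x \<pi>'"
        using block_in_nonsingletons[OF sp(1) x] block_in_nonsingletons[OF sp(2) x'] by simp_all
      have "x \<in> B \<longleftrightarrow> block x \<pi> = B"
        using block_eqI[OF sp(1) B] b(2) by blast
      also have "\<dots> \<longleftrightarrow> Min (block x \<pi>) = Min B"
        using nonsingletonsD(7)[OF sp(1) b(1)] B_facts(7) by metis
      also have "\<dots> \<longleftrightarrow> Min (block x \<pi>') = Min B'"
        using eq[OF x] min by simp
      also have "\<dots> \<longleftrightarrow> block x \<pi>' = B'"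
        using nonsingletonsD(7)[OF sp(2) b(3)] B'_facts(7) by metis
      also have "\<dots> \<longleftrightarrow> x \<in> B'"
        using block_eqI[OF sp(2) B'_facts(1)] b(4) by blast
      finally show ?thesis .
    qed
    have "B = B'"
      using same B_facts(8) B'_facts(8) core by blast
    then show ?thesis using B'_facts(1) by simp
  qed
qed

text \<open>Minima and maxima act as opening and closing brackets. A noncrossing partition matches
  them as nested brackets, and every core point belongs to the innermost pair around it.\<close>

lemma NC_determined_by_min_max:
  assumes \<pi>: "\<pi> \<in> NC n" and \<pi>': "\<pi>' \<in> NC n" and core: "core \<pi> = core \<pi>'"
    and mins: "Min ` nonsingletons \<pi> = Min ` nonsingletons \<pi>'"
    and maxs: "Max ` nonsingletons \<pi> = Max ` nonsingletons \<pi>'"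
  shows "\<pi> = \<pi>'"
proof -
  have eq: "Min (block x \<pi>) = Min (block x \<pi>')" if x: "x \<in> core \<pi>" for x
  proof -
    have x': "x \<in> core \<pi>'" using x unfolding core .
    show ?thesis
      using NC_min_not_less[OF \<pi> \<pi>' core mins maxs x]
        NC_min_not_less[OF \<pi>' \<pi> core[symmetric] mins[symmetric] maxs[symmetric] x']
      by linarith
  qed
  have sp: "\<pi> \<in> set_partitions n" "\<pi>' \<in> set_partitions n"
    using \<pi> \<pi>' by (auto simp: NC_def)
  show ?thesis
  proof (rule subset_antisym)
    show "\<pi> \<subseteq> \<pi>'"
      by (rule subset_if_same_block_mins[OF sp core eq])
    show "\<pi>' \<subseteq> \<pi>"
      by (rule subset_if_same_block_mins[OF sp(2,1) core[symmetric] eq[symmetric]]) (simp only: core)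
  qed
qed

text \<open>Passing from a noncrossing partition to another one on which its own form does not vanish
  strictly increases this statistic, which makes the pairing triangular.\<close>

definition total_width :: "setpart \<Rightarrow> int" where
  "total_width \<pi> = (\<Sum>B\<in>nonsingletons \<pi>. int (Max B) - int (Min B))"

text \<open>Rows and columns are the block minima and maxima of \<pi>. If the determinant is nonzero
  at \<rho>, the nonsingleton blocks of \<rho> each contain one \<open>s i\<close> together with
  \<open>t (\<sigma> i)\<close>, so they are at least as wide as the difference. These differences
  sum to the width of \<pi> since \<sigma> only permutes the maxima. Equality makes all minima and
  maxima agree, which determines a noncrossing partition.\<close>

lemma leading_link_form:
  assumes \<pi>: "\<pi> \<in> NC n"
  obtains N k s t where "s ` {..<k} \<inter> t ` {..<k} = {}" "link_form N k s t \<pi> = 1"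
    "\<forall>\<rho>\<in>NC n. link_form N k s t \<rho> \<noteq> 0 \<longrightarrow> total_width \<pi> < total_width \<rho> \<or> \<rho> = \<pi>"
proof -
  have sp: "\<pi> \<in> set_partitions n" using \<pi> by (simp add: NC_def)
  then have fin: "finite (nonsingletons \<pi>)"
    using set_partitionsD(1) by (simp add: nonsingletons_def)
  define k where "k = card (nonsingletons \<pi>)"
  obtain b where b: "bij_betw b {..<k} (nonsingletons \<pi>)"
    using ex_bij_betw_nat_finite[OF fin] by (auto simp: k_def atLeast0LessThan)
  define s t where "s i = Min (b i)" and "t i = Max (b i)" for i
  have bi: "b i \<in> nonsingletons \<pi>" if "i < k" for i
    using b that by (auto simp: bij_betw_def)
  have b_eq: "b i = b j \<longleftrightarrow> i = j" if "i < k" "j < k" for i j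
    using b that by (auto simp: bij_betw_def inj_on_eq_iff)
  have linked: "linked \<pi> (s i) (t j) \<longleftrightarrow> i = j" if ij: "i < k" "j < k" for i j
  proof -
    note I = nonsingletonsD[OF sp bi[OF ij(1)]] and J = nonsingletonsD[OF sp bi[OF ij(2)]]
    have "linked \<pi> (s i) (t j) \<longleftrightarrow> t j \<in> b i"
      by (rule linked_iff[OF sp I(1)]) (simp add: s_def I(4))
    also have "\<dots> \<longleftrightarrow> b i = b j"
      using set_partitionsD(5)[OF sp I(1) J(1)] J(5) by (auto simp: t_def)
    finally show ?thesis using b_eq ij by simp
  qed
  have disj: "s ` {..<k} \<inter> t ` {..<k} = {}"
  proof -
    have "s i \<noteq> t j" if ij: "i < k" "j < k" for i j
    proof
      assume eq: "s i = t j"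
      note I = nonsingletonsD[OF sp bi[OF ij(1)]] and J = nonsingletonsD[OF sp bi[OF ij(2)]]
      have "b i = b j"
        using set_partitionsD(5)[OF sp I(1) J(1), of "s i"] I(4) J(5) eq by (simp add: s_def t_def)
      with eq I(6) show False by (simp add: s_def t_def)
    qed
    then show ?thesis by blast
  qed
  \<comment> \<open>The link matrix of \<pi> itself is the identity matrix, so only the identity
    permutation contributes.\<close>
  have "link_det k s t \<pi> = (\<Sum>\<sigma> | \<sigma> permutes {..<k}. if \<sigma> = id then 1 else 0)"
    unfolding link_det_def
  proof (rule sum.cong[OF refl])
    fix \<sigma> assume "\<sigma> \<in> {\<sigma>. \<sigma> permutes {..<k}}"
    then have \<sigma>: "\<sigma> permutes {..<k}" by simp
    show "of_int (sign \<sigma>) * (\<Prod>i<k. of_bool (linked \<pi> (s i) (t (\<sigma> i)))) = (if \<sigma> = id then 1 else (0::rat))"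
    proof (cases "\<sigma> = id")
      case True
      then show ?thesis by (simp add: linked)
    next
      case False
      then obtain i where i: "\<sigma> i \<noteq> i" by (auto simp: fun_eq_iff)
      then have "i < k" using permutes_not_in[OF \<sigma>, of i] by (metis lessThan_iff)
      moreover have "\<sigma> i < k" using permutes_in_image[OF \<sigma>, of i] \<open>i < k\<close> by simp
      ultimately have "\<not> linked \<pi> (s i) (t (\<sigma> i))" using linked i by metis
      with \<open>i < k\<close> have "(\<Prod>i<k. of_bool (linked \<pi> (s i) (t (\<sigma> i)))) = (0::rat)"
        by (intro prod_zero) auto
      with False show ?thesis by simp
    qed
  qed
  also have "\<dots> = 1"
    by (subst sum.delta) (simp_all add: finite_permutations permutes_id)
  finally have one: "link_form (core \<pi>) k s t \<pi> = 1"
    by (simp add: link_form_def k_def)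
  have images: "s ` {..<k} = Min ` nonsingletons \<pi>" "t ` {..<k} = Max ` nonsingletons \<pi>"
    unfolding s_def[abs_def] t_def[abs_def] bij_betw_imp_surj_on[OF b, symmetric] image_image
    by (rule refl)+
  have "total_width \<pi> < total_width \<rho> \<or> \<rho> = \<pi>"
    if \<rho>: "\<rho> \<in> NC n" and nz: "link_form (core \<pi>) k s t \<rho> \<noteq> 0" for \<rho>
  proof -
    have sp': "\<rho> \<in> set_partitions n" using \<rho> by (simp add: NC_def)
    have core: "core \<rho> = core \<pi>" and card: "card (nonsingletons \<rho>) = k" and det: "link_det k s t \<rho> \<noteq> 0"
      using nz by (auto simp: link_form_def split: if_splits)
    define c where "c i = block (s i) \<rho>" for i
    obtain \<sigma> where \<sigma>: "\<sigma> permutes {..<k}" and lnk: "\<forall>i<k. linked \<rho> (s i) (t (\<sigma> i))"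
      and mem: "\<forall>i<k. s i \<in> block (s i) \<rho>"
      and c: "bij_betw (\<lambda>i. block (s i) \<rho>) {..<k} (nonsingletons \<rho>)"
      by (rule link_det_nonzero[OF sp' card disj det])
    note mem = mem[folded c_def] and c = c[folded c_def]
    have ci: "c i \<in> nonsingletons \<rho>" if "i < k" for i
      using c that by (auto simp: bij_betw_def)
    have bounds: "Min (c i) \<le> s i" "t (\<sigma> i) \<le> Max (c i)" if i: "i < k" for i
    proof -
      note C = nonsingletonsD[OF sp' ci[OF i]]
      have si: "s i \<in> c i" using mem i by blast
      have "linked \<rho> (s i) (t (\<sigma> i))" using lnk i by blast
      then have ti: "t (\<sigma> i) \<in> c i" by (rule iffD1[OF linked_iff[OF sp' C(1) si]])
      show "Min (c i) \<le> s i" "t (\<sigma> i) \<le> Max (c i)"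
        using si ti C(2) by simp_all
    qed
    have w\<rho>: "total_width \<rho> = (\<Sum>i<k. int (Max (c i)) - int (Min (c i)))"
      unfolding total_width_def by (rule sum.reindex_bij_betw[OF c, symmetric])
    have w\<pi>: "total_width \<pi> = (\<Sum>i<k. int (t (\<sigma> i)) - int (s i))"
    proof -
      have "total_width \<pi> = (\<Sum>i<k. int (t i) - int (s i))"
        unfolding total_width_def s_def t_def by (rule sum.reindex_bij_betw[OF b, symmetric])
      also have "\<dots> = (\<Sum>i<k. int (t (\<sigma> i))) - (\<Sum>i<k. int (s i))"
        using sum.reindex_bij_betw[OF permutes_imp_bij[OF \<sigma>], of "\<lambda>i. int (t i)"]
        by (simp add: sum_subtractf)
      finally show ?thesis by (simp add: sum_subtractf)
    qed
    have le: "int (t (\<sigma> i)) - int (s i) \<le> int (Max (c i)) - int (Min (c i))" if "i < k" for i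
      using bounds[OF that] by linarith
    show ?thesis
    proof (cases "total_width \<pi> < total_width \<rho>")
      case False
      have tight: "int (t (\<sigma> i)) - int (s i) = int (Max (c i)) - int (Min (c i))" if "i < k" for i
      proof (rule ccontr)
        assume "int (t (\<sigma> i)) - int (s i) \<noteq> int (Max (c i)) - int (Min (c i))"
        with le[OF that] have "int (t (\<sigma> i)) - int (s i) < int (Max (c i)) - int (Min (c i))" by simp
        then have "total_width \<pi> < total_width \<rho>"
          unfolding w\<pi> w\<rho> using le that by (intro sum_strict_mono_ex1) auto
        with False show False by simp
      qed
      have eqs: "s i = Min (c i)" "t (\<sigma> i) = Max (c i)" if "i < k" for i
        using tight[OF that] bounds[OF that] by linarith+
      have "Min ` nonsingletons \<rho> = (\<lambda>i. Min (c i)) ` {..<k}"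
        unfolding bij_betw_imp_surj_on[OF c, symmetric] image_image ..
      also have "\<dots> = s ` {..<k}"
        using eqs(1) by (intro image_cong) auto
      finally have mins: "Min ` nonsingletons \<rho> = Min ` nonsingletons \<pi>"
        by (simp only: images)
      have "Max ` nonsingletons \<rho> = (\<lambda>i. Max (c i)) ` {..<k}"
        unfolding bij_betw_imp_surj_on[OF c, symmetric] image_image ..
      also have "\<dots> = (\<lambda>i. t (\<sigma> i)) ` {..<k}"
        using eqs(2) by (intro image_cong) auto
      also have "\<dots> = t ` (\<sigma> ` {..<k})"
        by (simp only: image_image)
      also have "\<dots> = t ` {..<k}"
        by (simp only: permutes_image[OF \<sigma>])
      finally have maxs: "Max ` nonsingletons \<rho> = Max ` nonsingletons \<pi>"
        by (simp only: images)
      show ?thesis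
        using NC_determined_by_min_max[OF \<rho> \<pi> core mins maxs] by simp
    qed simp
  qed
  then have "\<forall>\<rho>\<in>NC n. link_form (core \<pi>) k s t \<rho> \<noteq> 0 \<longrightarrow> total_width \<pi> < total_width \<rho> \<or> \<rho> = \<pi>"
    by blast
  with disj one show thesis by (rule that)
qed

text \<open>For a partition of maximal width in the support, the leading form vanishes at all others
  in the support and so reads off a nonzero coefficient.\<close>

lemma V_space_inter_skein_kernel:
  assumes V: "x \<in> V_space n" and K: "x \<in> skein_kernel n"
  shows "x = 0"
proof (rule ccontr)
  assume "x \<noteq> 0"
  then have ne: "Poly_Mapping.keys x \<noteq> {}" by simp
  obtain \<pi> where \<pi>: "\<pi> \<in> Poly_Mapping.keys x"
    and max: "\<And>\<rho>. \<rho> \<in> Poly_Mapping.keys x \<Longrightarrow> total_width \<rho> \<le> total_width \<pi>"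
  proof -
    have "Max (total_width ` Poly_Mapping.keys x) \<in> total_width ` Poly_Mapping.keys x"
      using ne by (intro Max_in) auto
    then obtain \<pi> where \<pi>: "\<pi> \<in> Poly_Mapping.keys x"
      "total_width \<pi> = Max (total_width ` Poly_Mapping.keys x)" by auto
    show thesis by (rule that[OF \<pi>(1)]) (simp add: \<pi>(2))
  qed
  have NC: "\<rho> \<in> NC n" if "\<rho> \<in> Poly_Mapping.keys x" for \<rho>
    using V that by (auto simp: V_space_def)
  obtain N k s t where disj: "s ` {..<k} \<inter> t ` {..<k} = {}" and one: "link_form N k s t \<pi> = 1"
    and lead: "\<forall>\<rho>\<in>NC n. link_form N k s t \<rho> \<noteq> 0 \<longrightarrow> total_width \<pi> < total_width \<rho> \<or> \<rho> = \<pi>"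
    by (rule leading_link_form[OF NC[OF \<pi>]])
  have zero: "link_form N k s t \<rho> = 0" if "\<rho> \<in> Poly_Mapping.keys x" "\<rho> \<noteq> \<pi>" for \<rho>
  proof (rule ccontr)
    assume "link_form N k s t \<rho> \<noteq> 0"
    then have "total_width \<pi> < total_width \<rho>"
      using lead NC[OF that(1)] that(2) by blast
    with max[OF that(1)] show False by simp
  qed
  have "pairing (link_form N k s t) x = (\<Sum>\<rho>\<in>{\<pi>}. Poly_Mapping.lookup x \<rho> * link_form N k s t \<rho>)"
    unfolding pairing_def using \<pi> zero by (intro sum.mono_neutral_right) auto
  then have "pairing (link_form N k s t) x \<noteq> 0"
    using \<pi> one by (simp add: in_keys_iff)
  with K disj show False by (auto simp: skein_kernel_def)
qed

section \<open>Standard partitions\<close>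

definition std_block :: "nat list \<Rightarrow> nat \<Rightarrow> nat set" where
  "std_block ls j = {sum_list (take j ls) + 1 .. sum_list (take (Suc j) ls)}"

lemma std_part_eq: "std_part ls = std_block ls ` {..<length ls}"
  by (auto simp: std_part_def std_block_def)

lemma sum_list_take_mono: "i \<le> j \<Longrightarrow> sum_list (take i ls) \<le> sum_list (take j (ls :: nat list))"
  by (metis le_add1 le_add_diff_inverse sum_list_append take_add)

lemma Union_std_block: "m \<le> length ls \<Longrightarrow> (\<Union>j<m. std_block ls j) = {1..sum_list (take m ls)}"
proof (induction m)
  case (Suc m)
  have "(\<Union>j<Suc m. std_block ls j) = {1..sum_list (take m ls)} \<union> std_block ls m"
    using Suc by (simp add: lessThan_Suc Un_commute)
  also have "\<dots> = {1..sum_list (take (Suc m) ls)}"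
    unfolding std_block_def using sum_list_take_mono[of m "Suc m" ls] by auto
  finally show ?case .
qed simp

lemma std_block_less:
  assumes "i < j" "x \<in> std_block ls i" "y \<in> std_block ls j"
  shows "x < y"
  using assms sum_list_take_mono[of "Suc i" j ls] by (auto simp: std_block_def)

lemma card_std_block: "j < length ls \<Longrightarrow> card (std_block ls j) = ls ! j"
  by (simp add: std_block_def take_Suc_conv_app_nth)

lemma std_block_nonempty:
  assumes "int_partition n ls" "j < length ls"
  shows "std_block ls j \<noteq> {}"
proof -
  have "0 < ls ! j" using assms by (simp add: int_partition_def)
  then show ?thesis using card_std_block[OF assms(2)] by auto
qed

lemma inj_on_std_block:
  assumes "int_partition n ls"
  shows "inj_on (std_block ls) {..<length ls}"
proof (rule linorder_inj_onI)
  fix i j assume "i < j" "i \<in> {..<length ls}" "j \<in> {..<length ls}"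
  then show "std_block ls i \<noteq> std_block ls j"
    using std_block_nonempty[OF assms, of i] std_block_less[of i j] by blast
qed auto

lemma std_part_in_NC:
  assumes "int_partition n ls"
  shows "std_part ls \<in> NC n"
proof -
  have "std_part ls \<in> set_partitions n"
  proof (rule set_partitionsI)
    show "\<Union>(std_part ls) = {1..n}"
      using Union_std_block[of "length ls" ls] assms by (simp add: std_part_eq int_partition_def)
    show "{} \<notin> std_part ls"
      using std_block_nonempty[OF assms] by (auto simp: std_part_eq)
    fix A B x assume "A \<in> std_part ls" "B \<in> std_part ls" "x \<in> A" "x \<in> B"
    then obtain i j where "A = std_block ls i" "B = std_block ls j" "x \<in> std_block ls i" "x \<in> std_block ls j"
      by (auto simp: std_part_eq)
    then show "A = B"
      using std_block_less[of i j x ls x] std_block_less[of j i x ls x] by (cases i j rule: linorder_cases) auto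
  qed
  moreover have "noncrossing (std_part ls)"
    unfolding noncrossing_iff
  proof (intro ballI impI notI)
    fix C D assume "C \<in> std_part ls" "D \<in> std_part ls" "C \<noteq> D" and cr: "crossing C D"
    then obtain i j where ij: "C = std_block ls i" "D = std_block ls j" "i \<noteq> j"
      by (auto simp: std_part_eq)
    from cr obtain a b c d where "a < b" "b < c" "c < d" "a \<in> C" "c \<in> C" "b \<in> D" "d \<in> D"
      by (rule crossingE)
    then show False
      using ij std_block_less[of i j c ls b] std_block_less[of j i b ls a]
      by (cases i j rule: linorder_cases) auto
  qed
  ultimately show ?thesis by (simp add: NC_def)
qed

lemma mset_std_part:
  assumes "int_partition n ls"
  shows "image_mset card (mset_set (std_part ls)) = mset ls"
proof -
  have "image_mset card (mset_set (std_part ls))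
      = image_mset card (image_mset (std_block ls) (mset_set {..<length ls}))"
    by (simp add: std_part_eq image_mset_mset_set[OF inj_on_std_block[OF assms]])
  also have "\<dots> = image_mset (\<lambda>j. ls ! j) (mset_set {..<length ls})"
    by (simp add: multiset.map_comp) (rule image_mset_cong, simp add: card_std_block)
  also have "\<dots> = mset (map ((!) ls) [0..<length ls])"
    by (simp add: lessThan_atLeast0 del: map_nth)
  finally show ?thesis by (simp add: map_nth)
qed

lemma mset_perm_part:
  assumes "inj w"
  shows "image_mset card (mset_set (perm_part w \<pi>)) = image_mset card (mset_set \<pi>)"
proof -
  have "inj_on ((`) w) \<pi>"
    using assms by (auto simp: inj_on_def inj_image_eq_iff)
  then have "image_mset card (mset_set (perm_part w \<pi>)) = image_mset (\<lambda>B. card (w ` B)) (mset_set \<pi>)"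
    by (simp add: perm_part_def image_mset_mset_set[symmetric] multiset.map_comp comp_def)
  also have "\<dots> = image_mset card (mset_set \<pi>)"
    using assms by (simp add: card_image inj_on_subset)
  finally show ?thesis .
qed

text \<open>Relabelling preserves the multiset of block sizes, and a decreasing list is determined
  by its multiset.\<close>

lemma std_part_shape_unique:
  assumes "int_partition n ls" "w permutes {1..n}" "perm_part w \<pi> = std_part ls"
    and "int_partition n ls'" "w' permutes {1..n}" "perm_part w' \<pi> = std_part ls'"
  shows "ls = ls'"
proof -
  have "mset ls = mset ls'"
    using mset_std_part[OF assms(1)] mset_std_part[OF assms(4)] assms(3,6)
      mset_perm_part[OF permutes_inj[OF assms(2)], of \<pi>] mset_perm_part[OF permutes_inj[OF assms(5)], of \<pi>]
    by metis
  moreover have "sorted (rev ls)" "sorted (rev ls')"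
    using assms(1,4) by (simp_all add: int_partition_def sorted_wrt_rev)
  ultimately have "rev ls = rev ls'"
    by (metis mset_rev properties_for_sort)
  then show ?thesis by simp
qed

text \<open>Glue bijections from \<open>A i\<close> to \<open>B i\<close>. The result maps S onto S,
  and finiteness makes it injective.\<close>

lemma permutation_between_families:
  assumes A: "\<And>i j. i < m \<Longrightarrow> j < m \<Longrightarrow> i \<noteq> j \<Longrightarrow> A i \<inter> A j = {}" "(\<Union>i<m. A i) = S"
    and B: "(\<Union>i<m. B i) = S" and fin: "finite S"
    and card: "\<And>i. i < m \<Longrightarrow> card (A i) = card (B i)"
  obtains w where "w permutes S" "\<forall>i<m. w ` A i = B i"
proof -
  have sub: "A i \<subseteq> S" "B i \<subseteq> S" if "i < m" for i
    using that A(2) B by blast+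
  have "\<exists>h. bij_betw h (A i) (B i)" if i: "i < m" for i
    using finite_subset[OF sub(1)[OF i] fin] finite_subset[OF sub(2)[OF i] fin] card[OF i]
    by (rule finite_same_card_bij)
  then obtain h where h: "bij_betw (h i) (A i) (B i)" if "i < m" for i
    by metis
  define w where "w x = (if x \<in> S then h (THE i. i < m \<and> x \<in> A i) x else x)" for x
  have w_eq: "w x = h i x" if "i < m" "x \<in> A i" for i x
  proof -
    have "(THE i. i < m \<and> x \<in> A i) = i"
    proof (rule the_equality)
      show "i < m \<and> x \<in> A i" using that by simp
      show "j = i" if "j < m \<and> x \<in> A j" for j
        using A(1)[of j i] that \<open>i < m\<close> \<open>x \<in> A i\<close> by blast
    qed
    moreover have "x \<in> S" using sub(1) that by blast
    ultimately show ?thesis by (simp add: w_def)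
  qed
  have img: "w ` A i = B i" if i: "i < m" for i
  proof -
    have "w ` A i = h i ` A i"
      by (rule image_cong) (simp_all add: w_eq[OF i])
    then show ?thesis using bij_betw_imp_surj_on[OF h[OF i]] by simp
  qed
  have "w ` S = (\<Union>i<m. w ` A i)"
    unfolding A(2)[symmetric] by (rule image_UN)
  also have "\<dots> = S"
    unfolding B[symmetric] by (rule SUP_cong) (simp_all add: img)
  finally have "w ` S = S" .
  moreover from this have "inj_on w S"
    by (intro finite_surj_inj[OF fin]) simp
  ultimately have "w permutes S"
    by (intro bij_imp_permutes) (simp_all add: bij_betw_def w_def)
  with img show thesis by (intro that) blast+
qed

lemma exists_std_part:
  assumes \<pi>: "\<pi> \<in> set_partitions n"
  shows "\<exists>ls w. int_partition n ls \<and> w permutes {1..n} \<and> perm_part w \<pi> = std_part ls"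
proof -
  obtain xs where xs: "set xs = \<pi>" "distinct xs"
    using finite_distinct_list[OF set_partitionsD(1)[OF \<pi>]] by blast
  \<comment> \<open>\<open>sort_key\<close> is increasing; reversal puts the largest block first, as
    an integer partition requires.\<close>
  define bs where "bs = rev (sort_key card xs)"
  have bs: "set bs = \<pi>" "distinct bs"
    using xs by (simp_all add: bs_def)
  define ls where "ls = map card bs"
  have bs_nth: "bs ! i \<in> \<pi>" if "i < length bs" for i
    using bs(1) nth_mem[OF that] by simp
  have Un: "(\<Union>i<length bs. bs ! i) = {1..n}"
  proof -
    have "(\<lambda>i. bs ! i) ` {..<length bs} = \<pi>"
      using bs(1) by (auto simp: set_conv_nth)
    then show ?thesis using set_partitionsD(6)[OF \<pi>] by simp
  qed
  have disj: "bs ! i \<inter> bs ! j = {}" if "i < length bs" "j < length bs" "i \<noteq> j" for i j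
  proof -
    have "bs ! i \<noteq> bs ! j"
      using bs(2) that by (simp add: nth_eq_iff_index_eq)
    then show ?thesis
      using set_partitionsD(5)[OF \<pi> bs_nth[OF that(1)] bs_nth[OF that(2)]] by blast
  qed
  have ip: "int_partition n ls"
  proof -
    have "sorted_wrt (\<ge>) ls"
      by (simp add: ls_def bs_def rev_map[symmetric] sorted_wrt_rev)
    moreover have "0 < k" if "k \<in> set ls" for k
      using that set_partitionsD(3,4)[OF \<pi>] bs(1) by (auto simp: ls_def card_gt_0_iff)
    moreover have "sum_list ls = n"
    proof -
      have "sum_list ls = (\<Sum>B\<in>\<pi>. card B)"
        using bs by (simp add: ls_def sum_list_distinct_conv_sum_set)
      also have "\<dots> = card (\<Union>\<pi>)"
        using \<pi> set_partitionsD(3)[OF \<pi>]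
        by (intro card_Union_disjoint[symmetric]) (auto simp: set_partitions_def partition_on_def)
      finally show ?thesis using set_partitionsD(6)[OF \<pi>] by simp
    qed
    ultimately show ?thesis by (simp add: int_partition_def)
  qed
  have len: "length ls = length bs" by (simp add: ls_def)
  have Un': "(\<Union>i<length bs. std_block ls i) = {1..n}"
    using Union_std_block[of "length bs" ls] ip len by (simp add: int_partition_def)
  have card: "card (bs ! i) = card (std_block ls i)" if "i < length bs" for i
    using card_std_block[of i ls] that by (simp add: ls_def)
  obtain w where w: "w permutes {1..n}" "\<forall>i<length bs. w ` (bs ! i) = std_block ls i"
    by (rule permutation_between_families[OF disj Un Un' finite_atLeastAtMost card])
  have "perm_part w \<pi> = (\<lambda>i. w ` (bs ! i)) ` {..<length bs}"
    unfolding perm_part_def bs(1)[symmetric] by (auto simp: set_conv_nth)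
  also have "\<dots> = std_block ls ` {..<length bs}"
    using w(2) by (intro image_cong) auto
  finally have "perm_part w \<pi> = std_part ls"
    by (simp add: std_part_eq len)
  with ip w(1) show ?thesis by blast
qed

lemma shape_facts:
  assumes "\<pi> \<in> set_partitions n"
  shows "int_partition n (shape n \<pi>)" "\<exists>w. standardizes n w \<pi>"
proof -
  let ?P = "\<lambda>ls. int_partition n ls \<and> (\<exists>w. w permutes {1..n} \<and> perm_part w \<pi> = std_part ls)"
  obtain ls where ls: "?P ls" using exists_std_part[OF assms] by blast
  have "shape n \<pi> = ls"
    unfolding shape_def
  proof (rule the_equality)
    show "ls' = ls" if "?P ls'" for ls'
      using std_part_shape_unique that ls by metis
  qed (rule ls)
  with ls show "int_partition n (shape n \<pi>)" "\<exists>w. standardizes n w \<pi>"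
    by (auto simp: standardizes_def)
qed

section \<open>The projection along the kernel\<close>

lemma lin_ext_fun_diff: "lin_ext f x - lin_ext g x = lin_ext (\<lambda>\<pi>. f \<pi> - g \<pi>) x"
  by (induction x rule: vec_induct[OF subset_UNIV])
     (simp_all add: lin_ext_add lin_ext_scale scale_diff[symmetric] algebra_simps)

lemma lin_ext_basis_id: "lin_ext basis x = x"
  using basis_expansion[of x] by (simp add: lin_ext_def)

lemma tau_kernel:
  assumes i: "i \<in> {1..<n}" and x: "x \<in> V_space n"
  shows "lin_ext (tau_gen n i) x \<in> V_space n"
    and "star_map (adj i) x - lin_ext (tau_gen n i) x \<in> skein_kernel n"
proof -
  have keys: "Poly_Mapping.keys x \<subseteq> NC n" using x by (simp add: V_space_def)
  show "lin_ext (tau_gen n i) x \<in> V_space n"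
    by (rule lin_ext_in_subspace[OF is_subspace_V_space keys tau_gen_facts(1)[OF _ i]])
  have "star_map (adj i) x = lin_ext (star_gen i) x"
    using star_map_adj[OF i] x V_space_subset_P_space by blast
  moreover have "lin_ext (\<lambda>\<pi>. star_gen i \<pi> - tau_gen n i \<pi>) x \<in> skein_kernel n"
    by (rule lin_ext_in_subspace[OF is_subspace_skein_kernel keys tau_gen_facts(2)[OF _ i]])
  ultimately show "star_map (adj i) x - lin_ext (tau_gen n i) x \<in> skein_kernel n"
    by (simp add: lin_ext_fun_diff)
qed

lemma star_map_diff: "star_map w (x - y) = star_map w x - star_map w y"
  by (simp add: star_map_def lin_ext_diff)

text \<open>The sum of V(n) and the kernel is stable under the generators: \<open>tau_kernel\<close>
  handles the component in V(n), and the kernel is a submodule.\<close>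

lemma star_map_decompose:
  assumes w: "w permutes {1..n}" and x: "x \<in> V_space n"
  shows "\<exists>v\<in>V_space n. star_map w x - v \<in> skein_kernel n"
  using w
proof (induction w rule: permutes_adj_induct)
  case id
  then show ?case
    using x is_subspace_zero[OF is_subspace_skein_kernel] by (intro bexI[of _ x]) (simp_all add: star_map_id[unfolded id_def])
next
  case (adj i w)
  then obtain v where v: "v \<in> V_space n" "star_map w x - v \<in> skein_kernel n" by blast
  note tau = tau_kernel[OF adj(1) v(1)]
  have "star_map (adj i \<circ> w) x = star_map (adj i) (star_map w x)"
    by (rule star_map_compose[OF permutes_inj[OF adj_permutes[OF adj(1)]] permutes_inj[OF adj(2)]])
  then have "star_map (adj i \<circ> w) x - lin_ext (tau_gen n i) v
      = star_map (adj i) (star_map w x - v) + (star_map (adj i) v - lin_ext (tau_gen n i) v)"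
    by (simp only: star_map_diff) simp
  also have "\<dots> \<in> skein_kernel n"
    by (rule is_subspace_add[OF is_subspace_skein_kernel
          star_map_skein_kernel[OF adj_permutes[OF adj(1)] v(2)] tau(2)])
  finally show ?case using tau(1) by blast
qed

lemma star_map_inverse:
  assumes w: "w permutes {1..n}"
  shows "star_map (inv' w) (star_map w x) = x"
proof -
  have "star_map (inv' w) (star_map w x) = star_map (inv' w \<circ> w) x"
    using star_map_compose[OF permutes_inj[OF permutes_inv[OF w]] permutes_inj[OF w]] by metis
  then show ?thesis
    using permutes_inv_o(2)[OF w] star_map_id by metis
qed

lemma standardized_in_V_space:
  assumes \<pi>: "\<pi> \<in> set_partitions n" and w: "standardizes n w \<pi>"
  shows "star_map w (basis \<pi>) \<in> V_space n"
  using std_part_in_NC[OF shape_facts(1)[OF \<pi>]] w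
  by (auto simp: star_map_basis standardizes_def intro: is_subspace_scale[OF is_subspace_V_space])

text \<open>A basis vector is obtained from w \<star> \<pi> by the inverse of w. For a standardizing
  w this vector is plus or minus a standard partition, so it lies in V(n), and its orbit stays in
  the sum of V(n) and the kernel.\<close>

lemma decompose:
  assumes "x \<in> P_space n"
  shows "\<exists>v\<in>V_space n. x - v \<in> skein_kernel n"
proof -
  have keys: "Poly_Mapping.keys x \<subseteq> set_partitions n" using assms by (simp add: P_space_def)
  have "\<exists>v\<in>V_space n. basis \<pi> - v \<in> skein_kernel n" if \<pi>: "\<pi> \<in> set_partitions n" for \<pi>
  proof -
    obtain w where w: "standardizes n w \<pi>" using shape_facts(2)[OF \<pi>] by blast
    then have "w permutes {1..n}" by (simp add: standardizes_def)
    with star_map_decompose[OF permutes_inv standardized_in_V_space[OF \<pi> w]] star_map_inverse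
    show ?thesis by metis
  qed
  then obtain v where v: "v \<pi> \<in> V_space n" "basis \<pi> - v \<pi> \<in> skein_kernel n"
    if "\<pi> \<in> set_partitions n" for \<pi> by metis
  have "lin_ext v x \<in> V_space n"
    by (rule lin_ext_in_subspace[OF is_subspace_V_space keys v(1)])
  moreover have "lin_ext (\<lambda>\<pi>. basis \<pi> - v \<pi>) x \<in> skein_kernel n"
    by (rule lin_ext_in_subspace[OF is_subspace_skein_kernel keys v(2)])
  then have "x - lin_ext v x \<in> skein_kernel n"
    unfolding lin_ext_fun_diff[symmetric] lin_ext_basis_id .
  ultimately show ?thesis by blast
qed

text \<open>On P(n) the description is proper: \<open>decompose\<close> gives existence,
  \<open>V_space_inter_skein_kernel\<close> uniqueness.\<close>

definition kernel_proj :: "nat \<Rightarrow> vec \<Rightarrow> vec" where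
  "kernel_proj n x = (THE v. v \<in> V_space n \<and> x - v \<in> skein_kernel n)"

lemma kernel_proj_eqI:
  assumes "v \<in> V_space n" "x - v \<in> skein_kernel n"
  shows "kernel_proj n x = v"
  unfolding kernel_proj_def
proof (rule the_equality)
  fix u assume u: "u \<in> V_space n \<and> x - u \<in> skein_kernel n"
  have "(x - v) - (x - u) \<in> skein_kernel n"
    by (rule is_subspace_diff[OF is_subspace_skein_kernel]) (simp_all add: u assms)
  moreover have "u - v \<in> V_space n"
    by (rule is_subspace_diff[OF is_subspace_V_space]) (simp_all add: u assms)
  ultimately have "u - v = 0"
    by (intro V_space_inter_skein_kernel) simp_all
  then show "u = v" by simp
qed (use assms in simp)

lemma kernel_proj:
  assumes "x \<in> P_space n"
  shows "kernel_proj n x \<in> V_space n" "x - kernel_proj n x \<in> skein_kernel n"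
  using decompose[OF assms] kernel_proj_eqI by auto

lemma kernel_proj_V: "x \<in> V_space n \<Longrightarrow> kernel_proj n x = x"
  by (rule kernel_proj_eqI) (simp_all add: is_subspace_zero[OF is_subspace_skein_kernel])

lemma kernel_proj_cong:
  assumes "y \<in> P_space n" "x - y \<in> skein_kernel n"
  shows "kernel_proj n x = kernel_proj n y"
proof (rule kernel_proj_eqI)
  show "kernel_proj n y \<in> V_space n" by (rule kernel_proj(1)[OF assms(1)])
  have "(x - y) + (y - kernel_proj n y) \<in> skein_kernel n"
    by (rule is_subspace_add[OF is_subspace_skein_kernel assms(2) kernel_proj(2)[OF assms(1)]])
  then show "x - kernel_proj n y \<in> skein_kernel n" by simp
qed

text \<open>A vector and its projection differ by a kernel element, and the kernel is stable under
  u. Projecting between two factors is therefore harmless, which is the composition law of the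
  action on V(n).\<close>

lemma kernel_proj_star_map:
  assumes u: "u permutes {1..n}" and x: "x \<in> P_space n"
  shows "kernel_proj n (star_map u x) = kernel_proj n (star_map u (kernel_proj n x))"
proof (rule kernel_proj_cong)
  show "star_map u (kernel_proj n x) \<in> P_space n"
    using kernel_proj(1)[OF x] V_space_subset_P_space star_map_P_space[OF u] by blast
  show "star_map u x - star_map u (kernel_proj n x) \<in> skein_kernel n"
    unfolding star_map_diff[symmetric] by (rule star_map_skein_kernel[OF u kernel_proj(2)[OF x]])
qed

text \<open>The action transported from the quotient is the witness for
  \<open>gen_action_eq\<close>; \<open>tau_kernel\<close> identifies its generators with the
  prescribed operators.\<close>

lemma skein_action_eq:
  assumes "w permutes {1..n}" "x \<in> V_space n"
  shows "skein_action n w x = kernel_proj n (star_map w x)"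
  unfolding skein_action_def
proof (rule gen_action_eq[where f = "\<lambda>w x. kernel_proj n (star_map w x)", OF _ _ _ _ assms])
  have P: "star_map w x \<in> P_space n" if "w permutes {1..n}" "x \<in> V_space n" for w x
    using star_map_P_space[OF that(1)] that(2) V_space_subset_P_space by blast
  show "kernel_proj n (star_map w x) \<in> V_space n" if "w permutes {1..n}" "x \<in> V_space n" for w x
    by (rule kernel_proj(1)[OF P[OF that]])
  show "kernel_proj n (star_map (u \<circ> w) x) = kernel_proj n (star_map u (kernel_proj n (star_map w x)))"
    if "u permutes {1..n}" "w permutes {1..n}" "x \<in> V_space n" for u w x
    using star_map_compose[OF permutes_inj[OF that(1)] permutes_inj[OF that(2)]]
      kernel_proj_star_map[OF that(1) P[OF that(2,3)]] by metis
  show "kernel_proj n (star_map id x) = x" if "x \<in> V_space n" for x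
    using star_map_id kernel_proj_V[OF that] by metis
  show "kernel_proj n (star_map (adj i) x) = lin_ext (tau_gen n i) x"
    if "i \<in> {1..<n}" "x \<in> V_space n" for i x
    by (rule kernel_proj_eqI[OF tau_kernel[OF that]])
qed

text \<open>The vector w \<star> \<pi> lies in V(n), so the inverse of w acts on it by \<star>
  followed by projection. The two \<star>-actions cancel and leave an expression without w, which is
  the independence of the choice.\<close>

lemma proj_via_eq:
  assumes \<pi>: "\<pi> \<in> set_partitions n" and w: "standardizes n w \<pi>"
  shows "proj_via n w \<pi> = kernel_proj n (basis \<pi>)"
proof -
  have perm: "w permutes {1..n}" using w by (simp add: standardizes_def)
  have "star n w (basis \<pi>) = star_map w (basis \<pi>)"
    by (rule star_eq_star_map[OF perm]) (simp add: \<pi>)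
  then show ?thesis
    unfolding proj_via_def
    using skein_action_eq[OF permutes_inv[OF perm] standardized_in_V_space[OF \<pi> w]] star_map_inverse[OF perm]
    by simp
qed

lemma proj_basis_eq:
  assumes "\<pi> \<in> set_partitions n"
  shows "proj_basis n \<pi> = kernel_proj n (basis \<pi>)"
  unfolding proj_basis_def
  by (rule proj_via_eq[OF assms someI_ex[OF shape_facts(2)[OF assms]]])

text \<open>The linear extension satisfies the characterization of \<open>kernel_proj\<close>,
  because it does so on basis vectors and V(n) and the kernel are subspaces.\<close>

lemma proj_eq:
  assumes "x \<in> P_space n"
  shows "proj n x = kernel_proj n x"
proof -
  have keys: "Poly_Mapping.keys x \<subseteq> set_partitions n" using assms by (simp add: P_space_def)
  have facts: "proj_basis n \<pi> \<in> V_space n" "basis \<pi> - proj_basis n \<pi> \<in> skein_kernel n"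
    if "\<pi> \<in> set_partitions n" for \<pi>
    using kernel_proj[of "basis \<pi>" n] that by (simp_all add: proj_basis_eq)
  have "lin_ext (proj_basis n) x \<in> V_space n"
    by (rule lin_ext_in_subspace[OF is_subspace_V_space keys facts(1)])
  moreover have "lin_ext (\<lambda>\<pi>. basis \<pi> - proj_basis n \<pi>) x \<in> skein_kernel n"
    by (rule lin_ext_in_subspace[OF is_subspace_skein_kernel keys facts(2)])
  then have "x - lin_ext (proj_basis n) x \<in> skein_kernel n"
    unfolding lin_ext_fun_diff[symmetric] lin_ext_basis_id .
  ultimately show ?thesis
    unfolding proj_def by (rule kernel_proj_eqI[symmetric])
qed

theorem theorem7p2:
  fixes n :: nat
  shows "(\<forall>\<pi>\<in>set_partitions n. \<exists>w. standardizes n w \<pi>)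
    \<and> (\<forall>\<pi>\<in>set_partitions n. \<forall>w w'. standardizes n w \<pi> \<longrightarrow> standardizes n w' \<pi> \<longrightarrow>
          proj_via n w \<pi> = proj_via n w' \<pi>)
    \<and> (\<forall>x\<in>P_space n. \<forall>y\<in>P_space n. proj n (x + y) = proj n x + proj n y)
    \<and> (\<forall>c. \<forall>x\<in>P_space n. proj n (scale c x) = scale c (proj n x))
    \<and> (\<forall>u. u permutes {1..n} \<longrightarrow>
          (\<forall>x\<in>P_space n. proj n (star n u x) = skein_action n u (proj n x)))
    \<and> proj n ` P_space n = V_space n
    \<and> (\<forall>\<pi>\<in>NC n. proj n (basis \<pi>) = basis \<pi>)
    \<and> (\<forall>\<pi>. almost_noncrossing n \<pi> \<longrightarrow> proj n (basis \<pi>) = - skein n \<pi>)"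
proof (intro conjI ballI allI impI)
  fix \<pi> assume "\<pi> \<in> set_partitions n"
  then show "\<exists>w. standardizes n w \<pi>" by (rule shape_facts(2))
next
  fix \<pi> w w' assume "\<pi> \<in> set_partitions n" "standardizes n w \<pi>" "standardizes n w' \<pi>"
  then show "proj_via n w \<pi> = proj_via n w' \<pi>" by (simp add: proj_via_eq)
next
  fix x y
  show "proj n (x + y) = proj n x + proj n y" by (simp add: proj_def lin_ext_add)
next
  fix c x
  show "proj n (scale c x) = scale c (proj n x)" by (simp add: proj_def lin_ext_scale)
next
  fix u x assume u: "u permutes {1..n}" and x: "x \<in> P_space n"
  show "proj n (star n u x) = skein_action n u (proj n x)"
    using star_eq_star_map[OF u x] proj_eq[OF star_map_P_space[OF u x]] proj_eq[OF x]
      skein_action_eq[OF u kernel_proj(1)[OF x]] kernel_proj_star_map[OF u x]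
    by simp
next
  show "proj n ` P_space n = V_space n"
  proof
    show "proj n ` P_space n \<subseteq> V_space n"
      using proj_eq kernel_proj(1) by auto
    show "V_space n \<subseteq> proj n ` P_space n"
    proof
      fix v assume v: "v \<in> V_space n"
      then have P: "v \<in> P_space n" using V_space_subset_P_space by blast
      have "proj n v = v" unfolding proj_eq[OF P] by (rule kernel_proj_V[OF v])
      with P show "v \<in> proj n ` P_space n" by (metis imageI)
    qed
  qed
next
  fix \<pi> assume "\<pi> \<in> NC n"
  then show "proj n (basis \<pi>) = basis \<pi>"
    using proj_eq[of "basis \<pi>" n] kernel_proj_V[of "basis \<pi>" n] by (simp add: NC_def)
next
  fix \<pi> assume anc: "almost_noncrossing n \<pi>"
  then have "\<pi> \<in> set_partitions n"
    by (auto simp: almost_noncrossing_def crosses_at_def)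
  \<comment> \<open>Subtracting -\<sigma>(\<pi>) from \<pi> gives \<pi> + \<sigma>(\<pi>), which
    lies in the kernel.\<close>
  moreover have "kernel_proj n (basis \<pi>) = - skein n \<pi>"
    using skein_facts[OF anc] by (intro kernel_proj_eqI) (simp_all add: is_subspace_uminus[OF is_subspace_V_space])
  ultimately show "proj n (basis \<pi>) = - skein n \<pi>"
    by (simp add: proj_eq)
qed

end
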